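(* Let $X$ and $Y$ be two independent positive random variables having positive densities on $(0,\infty)$. Let $$U=\frac{Y}{1+X},\qquad V=X\left(1+\frac{Y}{1+X}\right),$$ and suppose that $U$ and $V$ are independent. Assume that the logarithms of the densities of $X$, $Y$, $U$ and $V$ are locally integrable on $(0,\infty)$. Then there exist constants $a,b,c>0$ such that $X\sim\mathcal{K}(a,b-a,c)$ and $Y\sim\mathcal{G}(b,c)$ or, equivalently, $U\sim\mathcal{K}(b,a-b,c)$ and $V\sim\mathcal{G}(a,c)$.
   Context: For $\alpha,\gamma>0$ and $\beta\in\mathbb{R}$, the Kummer distribution $\mathcal{K}(\alpha,\beta,\gamma)$ is the probability distribution on $(0,\infty)$ with density proportional to $\frac{x^{\alpha-1}}{(1+x)^{\alpha+\beta}}e^{-\gamma x}\mathbf{1}_{(0,\infty)}(x)$. For $\alpha,\gamma>0$, the Gamma distribution $\mathcal{G}(\alpha,\gamma)$ is the probability distribution with density proportional to $x^{\alpha-1}e^{-\gamma x}\mathbf{1}_{(0,\infty)}(x)$. A measurable function on $(0,\infty)$ is locally integrable if it is Lebesgue integrable on every compact subset of $(0,\infty)$. *)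

theory Defs
  imports "HOL-Probability.Probability"
begin

definition kummer_kernel :: "real \<Rightarrow> real \<Rightarrow> real \<Rightarrow> real \<Rightarrow> real" where
  "kummer_kernel \<alpha> \<beta> \<gamma> x =
     x powr (\<alpha> - 1) / (1 + x) powr (\<alpha> + \<beta>) * exp (- \<gamma> * x) * indicator {0<..} x"

definition gamma_kernel :: "real \<Rightarrow> real \<Rightarrow> real \<Rightarrow> real" where
  "gamma_kernel \<alpha> \<gamma> x = x powr (\<alpha> - 1) * exp (- \<gamma> * x) * indicator {0<..} x"

text \<open>
  The two laws are specified by densities proportional to the above kernels. For
  \<open>\<alpha> > 0\<close> and \<open>\<gamma> > 0\<close> the kernels are integrable with positive integral, so that
  dividing by the integral gives genuine probability densities; for other parameters
  the following two functions are not meaningful.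
\<close>

definition kummer_density :: "real \<Rightarrow> real \<Rightarrow> real \<Rightarrow> real \<Rightarrow> real" where
  "kummer_density \<alpha> \<beta> \<gamma> x =
     kummer_kernel \<alpha> \<beta> \<gamma> x / (\<integral>t. kummer_kernel \<alpha> \<beta> \<gamma> t \<partial>lborel)"

definition gamma_density :: "real \<Rightarrow> real \<Rightarrow> real \<Rightarrow> real" where
  "gamma_density \<alpha> \<gamma> x = gamma_kernel \<alpha> \<gamma> x / (\<integral>t. gamma_kernel \<alpha> \<gamma> t \<partial>lborel)"

definition kummer_distributed :: "'a measure \<Rightarrow> ('a \<Rightarrow> real) \<Rightarrow> real \<Rightarrow> real \<Rightarrow> real \<Rightarrow> bool" where
  "kummer_distributed M X \<alpha> \<beta> \<gamma> \<longleftrightarrow>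
     distributed M lborel X (\<lambda>x. ennreal (kummer_density \<alpha> \<beta> \<gamma> x))"

definition gamma_distributed :: "'a measure \<Rightarrow> ('a \<Rightarrow> real) \<Rightarrow> real \<Rightarrow> real \<Rightarrow> bool" where
  "gamma_distributed M X \<alpha> \<gamma> \<longleftrightarrow>
     distributed M lborel X (\<lambda>x. ennreal (gamma_density \<alpha> \<gamma> x))"

definition has_real_density :: "'a measure \<Rightarrow> ('a \<Rightarrow> real) \<Rightarrow> (real \<Rightarrow> real) \<Rightarrow> bool" where
  "has_real_density M X f \<longleftrightarrow>
     (\<forall>x. 0 \<le> f x) \<and> distributed M lborel X (\<lambda>x. ennreal (f x))"

text \<open>
  Measurability of \<open>f\<close> on the half-line is a consequence, since the half-line is a
  countable union of compact sets.
\<close>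

definition locally_integrable_pos :: "(real \<Rightarrow> real) \<Rightarrow> bool" where
  "locally_integrable_pos f \<longleftrightarrow>
     (\<forall>K. compact K \<and> K \<subseteq> {0<..} \<longrightarrow> set_integrable lebesgue K f)"

end

theory Submission
  imports Defs
begin

text \<open>
  The map \<open>(x, y) \<mapsto> (u, v)\<close> is an involution, so in the coordinates \<open>(x, u)\<close>, where
  \<open>y = u (1 + x)\<close> and \<open>v = x (1 + u)\<close>, independence gives two product formulas for the
  density of \<open>(X, U)\<close>. Taking logarithms,
  \<open>A(x) + B(u (1 + x)) = C(u) + D(x (1 + u))\<close> for almost all \<open>x, u > 0\<close>, with \<open>B, D\<close> the
  logarithms of the densities of \<open>Y, V\<close>, and \<open>A, C\<close> those of \<open>X, U\<close> up to the terms
  \<open>ln (1 + x)\<close>, \<open>ln (1 + u)\<close>.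

  Averaging over \<open>u\<close> shows that \<open>A\<close> gains one order of regularity over \<open>B\<close> and \<open>D\<close>;
  symmetrically for \<open>C\<close>. Fixing \<open>y\<close> shows that \<open>D\<close> is as regular as \<open>A\<close> and \<open>C\<close>;
  symmetrically for \<open>B\<close>. Hence all four functions may be taken twice differentiable.
  Applying \<open>\<partial>/\<partial>u \<partial>/\<partial>x\<close> yields \<open>(y B'(y))' = (v D'(v))'\<close>, and since \<open>y\<close> and \<open>v\<close> vary
  independently both sides are a constant. So \<open>Y\<close> and \<open>V\<close> have Gamma kernels with a common
  rate, integrability makes the parameters positive, and the product formula determines the
  remaining densities.
\<close>

section \<open>Regularity of the solutions\<close>

text \<open>Gauge integrability suffices for averaging over intervals; for \<open>t < s\<close> the
  interval is empty and the condition trivial.\<close>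

definition loc_int :: "(real \<Rightarrow> real) \<Rightarrow> bool" where
  "loc_int f \<longleftrightarrow> (\<forall>s t. 0 < s \<longrightarrow> f integrable_on {s..t})"

text \<open>Iterated rather than over the product measure, so that almost every \<open>x\<close> can
  be fixed directly. Exchanging the two quantifiers takes Fubini and measurability.\<close>

definition ae_eqn :: "(real \<Rightarrow> real) \<Rightarrow> (real \<Rightarrow> real) \<Rightarrow> (real \<Rightarrow> real) \<Rightarrow> (real \<Rightarrow> real) \<Rightarrow> bool" where
  "ae_eqn A B C D \<longleftrightarrow>
     (AE x in lborel. AE u in lborel. 0 < x \<longrightarrow> 0 < u \<longrightarrow>
        A x + B (u * (1 + x)) = C u + D (x * (1 + u)))"

definition eqn :: "(real \<Rightarrow> real) \<Rightarrow> (real \<Rightarrow> real) \<Rightarrow> (real \<Rightarrow> real) \<Rightarrow> (real \<Rightarrow> real) \<Rightarrow> bool" where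
  "eqn A B C D \<longleftrightarrow>
     (\<forall>x>0. \<forall>u>0. A x + B (u * (1 + x)) = C u + D (x * (1 + u)))"

section \<open>Null sets and changes of variable on the half-line\<close>

lemma AE_lborel_iff_negligible:
  fixes P :: "real \<Rightarrow> bool"
  shows "(AE x in lborel. P x) \<longleftrightarrow> negligible {x. \<not> P x}"
proof -
  have "(AE x in lborel. P x) \<longleftrightarrow> (AE x in lebesgue. P x)"
    by (simp add: AE_completion_iff)
  also have "\<dots> \<longleftrightarrow> {x. \<not> P x} \<in> null_sets lebesgue"
    by (simp add: AE_iff_null_sets completion.complete2 eventually_ae_filter)
       (metis completion.complete2 order_refl)
  finally show ?thesis by (simp add: negligible_iff_null_sets)
qed

lemma differentiable_on_posI:
  fixes f :: "real \<Rightarrow> real"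
  shows "(\<And>x. 0 < x \<Longrightarrow> f differentiable (at x)) \<Longrightarrow> f differentiable_on {0<..}"
  by (simp add: differentiable_on_def differentiable_at_withinI)

text \<open>The exceptional set of the conclusion lies in the image under \<open>g\<close> of that
  of the premise, and differentiable maps preserve null sets. Hence the left inverse, not
  \<open>h\<close>, has to be differentiable.\<close>

lemma AE_pos_comp:
  fixes P :: "real \<Rightarrow> bool" and g h :: "real \<Rightarrow> real"
  assumes "AE v in lborel. 0 < v \<longrightarrow> P v"
    and h: "\<And>x. 0 < x \<Longrightarrow> 0 < h x \<and> g (h x) = x"
    and g: "g differentiable_on {0<..}"
  shows "AE x in lborel. 0 < x \<longrightarrow> P (h x)"
proof -
  let ?N = "{v. \<not> (0 < v \<longrightarrow> P v)}"
  have "negligible (g ` ?N)"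
  proof (rule negligible_differentiable_image_negligible)
    show "negligible ?N" using assms(1) by (simp add: AE_lborel_iff_negligible)
    show "g differentiable_on ?N" using g by (rule differentiable_on_subset) auto
  qed simp
  moreover have "{x. \<not> (0 < x \<longrightarrow> P (h x))} \<subseteq> g ` ?N"
    using h by (force simp: image_iff)
  ultimately show ?thesis by (auto simp: AE_lborel_iff_negligible intro: negligible_subset)
qed

lemma AE_pos_scale:
  fixes P :: "real \<Rightarrow> bool"
  assumes "AE v in lborel. 0 < v \<longrightarrow> P v" and c: "0 < c"
  shows "AE x in lborel. 0 < x \<longrightarrow> P (c * x)"
  by (rule AE_pos_comp[OF assms(1), where g = "\<lambda>v. v / c"]) (use c in \<open>auto intro!: differentiable_on_posI derivative_intros\<close>)

text \<open>The set where \<open>f\<close> and \<open>g\<close> differ is open and null, hence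
  empty.\<close>

lemma AE_pos_eq_continuous:
  fixes f g :: "real \<Rightarrow> real"
  assumes ae: "AE x in lborel. 0 < x \<longrightarrow> f x = g x"
    and f: "continuous_on {0<..} f" and g: "continuous_on {0<..} g" and x: "0 < x"
  shows "f x = g x"
proof (rule ccontr)
  assume ne: "f x \<noteq> g x"
  let ?S = "{y \<in> {0<..}. (\<lambda>y. f y - g y) y \<in> - {0}}"
  have "open ?S"
    by (intro continuous_open_preimage[unfolded vimage_def Int_def, simplified] continuous_intros)
       (auto simp: f g continuous_on_diff)
  moreover have "negligible ?S"
    using ae unfolding AE_lborel_iff_negligible by (rule negligible_subset) auto
  ultimately have "?S = {}" using open_not_negligible by blast
  with ne x show False by auto
qed

text \<open>The inverse of \<open>x \<mapsto> x * (1 + y / (1 + x))\<close>, that is, \<open>x\<close> as a function of \<open>v\<close>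
  along the curve \<open>u * (1 + x) = y\<close>.\<close>

definition y_curve :: "real \<Rightarrow> real \<Rightarrow> real" where
  "y_curve y v = ((v - 1 - y) + sqrt ((v - 1 - y)\<^sup>2 + 4 * v)) / 2"

lemma y_curve_pos: assumes "0 < v" shows "0 < y_curve y v"
proof -
  have "\<bar>v - 1 - y\<bar> < sqrt ((v - 1 - y)\<^sup>2 + 4 * v)"
    using assms by (intro real_less_rsqrt) auto
  thus ?thesis by (auto simp: y_curve_def)
qed

text \<open>\<open>y_curve y v\<close> is the positive root of the quadratic
  \<open>x * (1 + x + y) = v * (1 + x)\<close>; the product of its roots is
  \<open>- v\<close>.\<close>

lemma y_curve_eq:
  assumes "0 < v" shows "y_curve y v * (1 + y / (1 + y_curve y v)) = v"
proof -
  let ?g = "y_curve y v"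
  have s: "(sqrt ((v - 1 - y)\<^sup>2 + 4 * v))\<^sup>2 = (v - 1 - y)\<^sup>2 + 4 * v" using assms by simp
  have "2 * ?g - (v - 1 - y) = sqrt ((v - 1 - y)\<^sup>2 + 4 * v)" by (simp add: y_curve_def field_simps)
  hence "(2 * ?g - (v - 1 - y))\<^sup>2 = (v - 1 - y)\<^sup>2 + 4 * v" using s by simp
  hence "?g * (1 + ?g + y) = v * (1 + ?g)" by (simp add: power2_eq_square algebra_simps)
  thus ?thesis using y_curve_pos[OF assms, of y] by (simp add: field_simps)
qed

lemma y_curve_DERIV:
  assumes "0 < v"
  shows "(y_curve y has_real_derivative
     (1 + (v + 1 - y) / sqrt ((v - 1 - y)\<^sup>2 + 4 * v)) / 2) (at v)"
proof -
  have "0 < (v - 1 - y)\<^sup>2 + 4 * v" using assms by (intro add_nonneg_pos) auto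
  thus ?thesis unfolding y_curve_def [abs_def]
    by (auto intro!: derivative_eq_intros simp: field_simps)
qed

lemma y_curve_continuous: "continuous_on {0<..} (y_curve y)"
  by (rule DERIV_continuous_on, rule has_field_derivative_at_within, rule y_curve_DERIV) simp

section \<open>Antiderivatives and averages over the interval from 1 to 2\<close>

lemma antiderivative_exists:
  fixes f :: "real \<Rightarrow> real"
  assumes "loc_int f"
  obtains F where "continuous_on {0<..} F"
    and "\<And>s t. 0 < s \<Longrightarrow> s \<le> t \<Longrightarrow> integral {s..t} f = F t - F s"
    and "continuous_on {0<..} f \<Longrightarrow> (\<And>x. 0 < x \<Longrightarrow> (F has_real_derivative f x) (at x))"
proof -
  \<comment> \<open>The integral is signed because the base point 1 is interior to the half-line.
    Integrability of \<open>f\<close> makes \<open>F\<close> continuous, continuity of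
    \<open>f\<close> makes it differentiable.\<close>
  define F where "F x = (if 1 \<le> x then integral {1..x} f else - integral {x..1} f)" for x
  have int: "f integrable_on {s..t}" if "0 < s" for s t
    using assms that unfolding loc_int_def by blast
  have F: "integral {s..t} f = F t - F s" if "0 < s" "s \<le> t" for s t
  proof -
    consider "1 \<le> s" | "s < 1" "1 \<le> t" | "t < 1" by linarith
    thus ?thesis
    proof cases
      case 1
      thus ?thesis using Henstock_Kurzweil_Integration.integral_combine[of 1 s t f] int[of 1 t] that
        by (simp add: F_def)
    next
      case 2
      thus ?thesis using Henstock_Kurzweil_Integration.integral_combine[of s 1 t f] int[of s t] that
        by (simp add: F_def)
    next
      case 3
      thus ?thesis using Henstock_Kurzweil_Integration.integral_combine[of s t 1 f] int[of s 1] that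
        by (simp add: F_def)
    qed
  qed
  have eq: "F x = F s + integral {s..x} f" if "0 < s" "s \<le> x" for s x using F[OF that] by simp
  have cont: "continuous_on {0<..} F"
  proof (rule continuous_at_imp_continuous_on, intro ballI)
    fix x :: real assume "x \<in> {0<..}"
    hence x: "0 < x" by simp
    \<comment> \<open>Starting at \<open>x/2\<close> keeps the interval inside the half-line and
      \<open>x\<close> in its interior.\<close>
    have "continuous_on {x/2..x+1} (\<lambda>z. F (x/2) + integral {x/2..z} f)"
      using x by (intro continuous_intros indefinite_integral_continuous_1 int) auto
    hence "continuous_on {x/2..x+1} F"
      by (rule continuous_on_eq) (use x in \<open>simp add: eq[of "x/2", symmetric]\<close>)
    hence "continuous_on {x/2<..<x+1} F" by (rule continuous_on_subset) auto
    thus "isCont F x" using x by (simp add: continuous_on_eq_continuous_at)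
  qed
  have der: "(F has_real_derivative f x) (at x)" if c: "continuous_on {0<..} f" and x: "0 < x" for x
  proof -
    have "((\<lambda>z. integral {x/2..z} f) has_real_derivative f x) (at x within {x/2..x+1})"
      using x c by (intro integral_has_real_derivative) (auto intro: continuous_on_subset)
    hence "((\<lambda>z. F (x/2) + integral {x/2..z} f) has_real_derivative f x) (at x within {x/2..x+1})"
      by (auto intro!: derivative_eq_intros)
    hence "(F has_real_derivative f x) (at x within {x/2..x+1})"
      by (rule has_field_derivative_transform_within[where d = 1])
         (use x in \<open>simp_all add: eq[of "x/2", symmetric]\<close>)
    thus ?thesis using x by (simp add: at_within_Icc_at)
  qed
  show ?thesis by (rule that[OF cont]) (fact F, fact der)
qed

lemma loc_int_continuous: "continuous_on {0<..} f \<Longrightarrow> loc_int f"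
  unfolding loc_int_def
  by (intro allI impI integrable_continuous_interval) (erule continuous_on_subset, auto)

text \<open>The endpoints stay unsimplified so that the arguments \<open>x * u + x\<close> and
  \<open>(1 + x) * u + 0\<close> are direct instances.\<close>

lemma has_integral_scale:
  fixes f :: "real \<Rightarrow> real"
  assumes f: "loc_int f" and F: "\<And>s t. 0 < s \<Longrightarrow> s \<le> t \<Longrightarrow> integral {s..t} f = F t - F s"
    and m: "0 < m" and c: "0 < m * 1 + c"
  shows "((\<lambda>u. f (m * u + c)) has_integral (F (m * 2 + c) - F (m * 1 + c)) / m) {1..2}"
proof -
  have le: "m * 1 + c \<le> m * 2 + c" using m by simp
  have "(f has_integral (F (m * 2 + c) - F (m * 1 + c))) (cbox (m * 1 + c) (m * 2 + c))"
    using f F[OF c le] c unfolding loc_int_def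
    by (metis box_real(2) integrable_integral)
  from has_integral_affinity[OF this, of m c]
  have "((\<lambda>u. f (m * u + c)) has_integral (F (m * 2 + c) - F (m * 1 + c)) / m)
     ((\<lambda>x. (1 / m) *\<^sub>R x + -((1 / m) *\<^sub>R c)) ` cbox (m * 1 + c) (m * 2 + c))"
    using m by (simp add: divide_inverse mult.commute)
  also have "(\<lambda>x. (1 / m) *\<^sub>R x + -((1 / m) *\<^sub>R c)) ` cbox (m * 1 + c) (m * 2 + c) = {1..2}"
    using m le by (subst image_affinity_cbox) (auto simp: field_simps)
  finally show ?thesis .
qed

text \<open>Integrating over \<open>u\<close> from 1 to 2 keeps \<open>A x\<close>, as the interval
  has length 1, and turns \<open>B\<close> and \<open>D\<close> into difference quotients of
  antiderivatives, which are one order more regular.\<close>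

lemma averaged_eqn:
  fixes A B C D :: "real \<Rightarrow> real"
  assumes B: "loc_int B" and FB: "\<And>s t. 0 < s \<Longrightarrow> s \<le> t \<Longrightarrow> integral {s..t} B = FB t - FB s"
    and D: "loc_int D" and FD: "\<And>s t. 0 < s \<Longrightarrow> s \<le> t \<Longrightarrow> integral {s..t} D = FD t - FD s"
    and C: "loc_int C" and x: "0 < x"
    and ae: "AE u in lborel. 0 < u \<longrightarrow> A x + B (u * (1 + x)) = C u + D (x * (1 + u))"
  shows "A x = integral {1..2} C + (FD (3 * x) - FD (2 * x)) / x
     - (FB (2 * (1 + x)) - FB (1 + x)) / (1 + x)"
proof -
  have "((\<lambda>u. C u + D (x * u + x) - B ((1 + x) * u + 0)) has_integral
     integral {1..2} C + (FD (x * 2 + x) - FD (x * 1 + x)) / x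
     - (FB ((1 + x) * 2 + 0) - FB ((1 + x) * 1 + 0)) / (1 + x)) {1..2}" (is "(?f has_integral ?I) _")
    using C x
    by (intro has_integral_add has_integral_diff has_integral_scale[OF D FD] has_integral_scale[OF B FB])
       (auto simp: loc_int_def has_integral_integral[symmetric])
  moreover have "negligible {u. \<not> (0 < u \<longrightarrow> A x + B (u * (1 + x)) = C u + D (x * (1 + u)))}"
    using ae by (simp add: AE_lborel_iff_negligible)
  \<comment> \<open>The equation fails only for a negligible set of \<open>u\<close>, which the
    integral does not see.\<close>
  ultimately have "((\<lambda>u. A x) has_integral ?I) {1..2::real}"
    by (rule has_integral_spike[rotated 2]) (auto simp: algebra_simps)
  moreover have "((\<lambda>u. A x) has_integral A x) {1..(2::real)}"
    using has_integral_const_real[of "A x" 1 2] by simp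
  ultimately have "A x = ?I" by (rule has_integral_unique[rotated])
  thus ?thesis by (simp add: algebra_simps)
qed

text \<open>Fubini for null sets.\<close>

lemma AE_lborel_commute:
  fixes P :: "real \<Rightarrow> real \<Rightarrow> bool"
  assumes "Measurable.pred (borel \<Otimes>\<^sub>M borel) (\<lambda>z. P (fst z) (snd z))"
    and "AE x in lborel. AE y in lborel. P x y"
  shows "AE y in lborel. AE x in lborel. P x y"
proof -
  have "sets (lborel \<Otimes>\<^sub>M lborel :: (real \<times> real) measure) = sets (borel \<Otimes>\<^sub>M borel)"
    by (intro sets_pair_measure_cong sets_lborel)
  hence "{z \<in> space (lborel \<Otimes>\<^sub>M lborel). P (fst z) (snd z)} \<in> sets (lborel \<Otimes>\<^sub>M lborel)"
    using assms(1) by (simp add: pred_def space_pair_measure)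
  from lborel_pair.AE_commute[OF this] assms(2) show ?thesis by simp
qed

text \<open>The equation is symmetric under exchanging \<open>x\<close> with \<open>u\<close> and
  \<open>(A, B)\<close> with \<open>(C, D)\<close>, so results on \<open>A\<close> and
  \<open>D\<close> carry over to \<open>C\<close> and \<open>B\<close>.\<close>

lemma ae_eqn_swap:
  assumes [measurable]: "A \<in> borel_measurable borel" "B \<in> borel_measurable borel"
    "C \<in> borel_measurable borel" "D \<in> borel_measurable borel"
    and ae: "ae_eqn A B C D"
  shows "ae_eqn C D A B"
proof -
  have "AE u in lborel. AE x in lborel. 0 < x \<longrightarrow> 0 < u \<longrightarrow>
      A x + B (u * (1 + x)) = C u + D (x * (1 + u))"
    using ae unfolding ae_eqn_def by (rule AE_lborel_commute[rotated]) measurable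
  thus ?thesis unfolding ae_eqn_def
  proof eventually_elim
    case (elim u)
    thus ?case by eventually_elim auto
  qed
qed

lemma eqn_swap: "eqn A B C D \<Longrightarrow> eqn C D A B"
  unfolding eqn_def by metis

lemma AE_pos_obtain:
  assumes "AE x in lborel. 0 < x \<longrightarrow> P x"
  obtains x :: real where "0 < x" "P x"
proof -
  have "\<not> (\<forall>x>0. \<not> P x)"
  proof
    assume "\<forall>x>0. \<not> P x"
    hence "negligible {0::real<..}"
      using assms unfolding AE_lborel_iff_negligible by (elim negligible_subset) auto
    thus False using open_not_negligible[of "{0::real<..}"] by auto
  qed
  with that show ?thesis by blast
qed

text \<open>With \<open>x = y_curve y v\<close> and \<open>u = y / (1 + x)\<close> the argument of
  \<open>B\<close> stays at \<open>y\<close> while that of \<open>D\<close> is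
  \<open>v\<close>.\<close>

lemma eqn_along_curve:
  assumes "eqn A B C D" "0 < v" "0 < y"
  shows "D v = A (y_curve y v) + B y - C (y / (1 + y_curve y v))"
proof -
  let ?x = "y_curve y v"
  have x: "0 < ?x" using assms by (simp add: y_curve_pos)
  have "A ?x + B (y / (1 + ?x) * (1 + ?x)) = C (y / (1 + ?x)) + D (?x * (1 + y / (1 + ?x)))"
    using assms(1,3) x by (intro assms(1)[unfolded eqn_def, rule_format]) auto
  thus ?thesis using x y_curve_eq[OF \<open>0 < v\<close>, of y] by simp
qed

section \<open>Continuous representatives of the four functions\<close>

lemma ae_eqn_continuous_first:
  assumes "loc_int B" "loc_int C" "loc_int D" "ae_eqn A B C D"
  obtains A' where "continuous_on {0<..} A'" "AE x in lborel. 0 < x \<longrightarrow> A x = A' x"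
proof -
  obtain FB where FB: "continuous_on {0<..} FB"
    "\<And>s t. 0 < s \<Longrightarrow> s \<le> t \<Longrightarrow> integral {s..t} B = FB t - FB s"
    using antiderivative_exists[OF assms(1)] by metis
  obtain FD where FD: "continuous_on {0<..} FD"
    "\<And>s t. 0 < s \<Longrightarrow> s \<le> t \<Longrightarrow> integral {s..t} D = FD t - FD s"
    using antiderivative_exists[OF assms(3)] by metis
  \<comment> \<open>The antiderivatives are continuous even though \<open>B\<close> and
    \<open>D\<close> are merely integrable.\<close>
  define A' where "A' x = integral {1..2} C + (FD (3 * x) - FD (2 * x)) / x
     - (FB (2 * (1 + x)) - FB (1 + x)) / (1 + x)" for x
  have "continuous_on {0<..} A'" unfolding A'_def
    by (intro continuous_intros continuous_on_compose2[OF FB(1)] continuous_on_compose2[OF FD(1)]) auto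
  moreover have "AE x in lborel. 0 < x \<longrightarrow> A x = A' x"
    using assms(4) unfolding ae_eqn_def
  proof eventually_elim
    case (elim x)
    thus ?case unfolding A'_def
      by (intro impI averaged_eqn[OF assms(1) FB(2) assms(3) FD(2) assms(2), where A = A]) simp_all
  qed
  ultimately show ?thesis by (rule that)
qed

text \<open>Along a curve on which \<open>u * (1 + x)\<close> is fixed, \<open>B\<close> contributes
  a constant, so \<open>D\<close> inherits the continuity of \<open>A'\<close> and
  \<open>C'\<close>.\<close>

lemma ae_eqn_continuous_last:
  assumes meas [measurable]: "A \<in> borel_measurable borel" "B \<in> borel_measurable borel"
    "C \<in> borel_measurable borel" "D \<in> borel_measurable borel"
    and ae: "ae_eqn A B C D"
    and A': "continuous_on {0<..} A'" "AE x in lborel. 0 < x \<longrightarrow> A x = A' x"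
    and C': "continuous_on {0<..} C'" "AE x in lborel. 0 < x \<longrightarrow> C x = C' x"
  obtains D' where "continuous_on {0<..} D'" "AE x in lborel. 0 < x \<longrightarrow> D x = D' x"
proof -
  have "AE x in lborel. AE y in lborel. 0 < x \<longrightarrow> 0 < y \<longrightarrow>
      A x + B y = C (y / (1 + x)) + D (x * (1 + y / (1 + x)))"
    using ae unfolding ae_eqn_def
  proof eventually_elim
    case (elim x)
    show ?case
    proof (cases "0 < x")
      case True
      with elim have "AE u in lborel. 0 < u \<longrightarrow> A x + B (u * (1 + x)) = C u + D (x * (1 + u))" by simp
      from AE_pos_scale[OF this, of "1 / (1 + x)"] show ?thesis using True by simp
    qed simp
  qed
  \<comment> \<open>Exchanging the quantifiers allows a single \<open>y\<close> to be fixed for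
    almost every \<open>x\<close>.\<close>
  hence "AE y in lborel. AE x in lborel. 0 < x \<longrightarrow> 0 < y \<longrightarrow>
      A x + B y = C (y / (1 + x)) + D (x * (1 + y / (1 + x)))"
    by (rule AE_lborel_commute[rotated]) measurable
  hence "AE y in lborel. 0 < y \<longrightarrow> (AE x in lborel. 0 < x \<longrightarrow>
      A x + B y = C (y / (1 + x)) + D (x * (1 + y / (1 + x))))"
  proof eventually_elim
    case (elim y)
    thus ?case by (cases "0 < y") auto
  qed
  then obtain y where y: "0 < y" and eq: "AE x in lborel. 0 < x \<longrightarrow>
      A x + B y = C (y / (1 + x)) + D (x * (1 + y / (1 + x)))"
    by (rule AE_pos_obtain)
  have "AE x in lborel. 0 < x \<longrightarrow> C (y / (1 + x)) = C' (y / (1 + x))"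
  proof (rule AE_pos_comp[OF C'(2), where g = "\<lambda>w. y / w - 1"])
    show "(\<lambda>w. y / w - 1) differentiable_on {0<..}"
      by (intro differentiable_on_posI derivative_intros) auto
  qed (use y in \<open>auto simp: field_simps\<close>)
  with eq A'(2) have "AE x in lborel. 0 < x \<longrightarrow>
      D (x * (1 + y / (1 + x))) = A' x + B y - C' (y / (1 + x))"
    by eventually_elim auto
  \<comment> \<open>The new variable is \<open>v\<close>, with \<open>x = y_curve y v\<close>; the
    left inverse is the explicit map from \<open>x\<close> to \<open>v\<close>.\<close>
  hence "AE v in lborel. 0 < v \<longrightarrow> D (y_curve y v * (1 + y / (1 + y_curve y v)))
      = A' (y_curve y v) + B y - C' (y / (1 + y_curve y v))"
  proof (rule AE_pos_comp[where g = "\<lambda>x. x * (1 + y / (1 + x))"])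
    show "(\<lambda>x. x * (1 + y / (1 + x))) differentiable_on {0<..}"
      by (intro differentiable_on_posI derivative_intros) auto
  qed (simp add: y_curve_pos y_curve_eq)
  hence "AE v in lborel. 0 < v \<longrightarrow> D v = A' (y_curve y v) + B y - C' (y / (1 + y_curve y v))"
    by eventually_elim (simp add: y_curve_eq)
  moreover have "continuous_on {0<..} (\<lambda>v. A' (y_curve y v) + B y - C' (y / (1 + y_curve y v)))"
  proof -
    have "0 < 1 + y_curve y v" if "0 < v" for v using y_curve_pos[OF that, of y] by simp
    hence "1 + y_curve y v \<noteq> 0" "0 < y / (1 + y_curve y v)" if "0 < v" for v
      using that y by (force, simp)
    thus ?thesis
      by (intro continuous_intros y_curve_continuous continuous_on_compose2[OF A'(1)]
          continuous_on_compose2[OF C'(1)]) (auto simp: y_curve_pos)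
  qed
  ultimately show ?thesis by (rule that[rotated])
qed

text \<open>Continuity removes the exceptional sets one variable at a time: first in
  \<open>u\<close> for almost every \<open>x\<close>, then in \<open>x\<close> for every
  \<open>u\<close>.\<close>

lemma eqn_of_ae_eqn:
  assumes ae: "ae_eqn A B C D"
    and c: "continuous_on {0<..} A'" "continuous_on {0<..} B'" "continuous_on {0<..} C'" "continuous_on {0<..} D'"
    and A': "AE x in lborel. 0 < x \<longrightarrow> A x = A' x" and B': "AE x in lborel. 0 < x \<longrightarrow> B x = B' x"
    and C': "AE x in lborel. 0 < x \<longrightarrow> C x = C' x" and D': "AE x in lborel. 0 < x \<longrightarrow> D x = D' x"
  shows "eqn A' B' C' D'"
proof -
  have "AE x in lborel. 0 < x \<longrightarrow> (\<forall>u>0. A' x + B' (u * (1 + x)) = C' u + D' (x * (1 + u)))"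
    using ae[unfolded ae_eqn_def] A'
  proof eventually_elim
    case (elim x)
    show ?case
    proof (intro impI allI)
      fix u :: real assume x: "0 < x" and u: "0 < u"
      have "AE u in lborel. 0 < u \<longrightarrow> B ((1 + x) * u) = B' ((1 + x) * u)"
        using AE_pos_scale[OF B', of "1 + x"] x by simp
      moreover have "AE u in lborel. 0 < u \<longrightarrow> D (x * (1 + u)) = D' (x * (1 + u))"
      proof (rule AE_pos_comp[OF D', where g = "\<lambda>v. v / x - 1"])
        show "(\<lambda>v. v / x - 1) differentiable_on {0<..}"
          using x by (intro differentiable_on_posI derivative_intros) auto
      qed (use x in \<open>auto simp: field_simps add_pos_pos\<close>)
      ultimately have "AE u in lborel. 0 < u \<longrightarrow> A' x + B' (u * (1 + x)) = C' u + D' (x * (1 + u))"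
        using elim(1) C' by eventually_elim (use x elim(2) in \<open>auto simp: mult.commute\<close>)
      thus "A' x + B' (u * (1 + x)) = C' u + D' (x * (1 + u))"
        by (rule AE_pos_eq_continuous)
           (use x u in \<open>auto intro!: continuous_intros c continuous_on_compose2[OF c(2)] continuous_on_compose2[OF c(4)]\<close>)
    qed
  qed
  hence ae': "AE x in lborel. 0 < x \<longrightarrow> A' x + B' (u * (1 + x)) = C' u + D' (x * (1 + u))" if "0 < u" for u
    by eventually_elim (use that in auto)
  have "A' x + B' (u * (1 + x)) = C' u + D' (x * (1 + u))" if "0 < x" "0 < u" for x u
    using ae'[OF that(2)]
    by (rule AE_pos_eq_continuous)
       (use that in \<open>auto intro!: continuous_intros c continuous_on_compose2[OF c(2)] continuous_on_compose2[OF c(4)]\<close>)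
  thus ?thesis by (simp add: eqn_def)
qed

lemma ae_eqn_continuous:
  assumes meas: "A \<in> borel_measurable borel" "B \<in> borel_measurable borel"
    "C \<in> borel_measurable borel" "D \<in> borel_measurable borel"
    and ae: "ae_eqn A B C D"
    and li: "loc_int A" "loc_int B" "loc_int C" "loc_int D"
  obtains A' B' C' D' where
    "continuous_on {0<..} A'" "continuous_on {0<..} B'" "continuous_on {0<..} C'" "continuous_on {0<..} D'"
    "AE x in lborel. 0 < x \<longrightarrow> B x = B' x" "AE x in lborel. 0 < x \<longrightarrow> D x = D' x" "eqn A' B' C' D'"
proof -
  have ae': "ae_eqn C D A B" using meas ae by (rule ae_eqn_swap)
  obtain A' where A': "continuous_on {0<..} A'" "AE x in lborel. 0 < x \<longrightarrow> A x = A' x"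
    using ae_eqn_continuous_first[OF li(2,3,4) ae] .
  obtain C' where C': "continuous_on {0<..} C'" "AE x in lborel. 0 < x \<longrightarrow> C x = C' x"
    using ae_eqn_continuous_first[OF li(4,1,2) ae'] .
  obtain D' where D': "continuous_on {0<..} D'" "AE x in lborel. 0 < x \<longrightarrow> D x = D' x"
    using ae_eqn_continuous_last[OF meas ae A' C'] .
  obtain B' where B': "continuous_on {0<..} B'" "AE x in lborel. 0 < x \<longrightarrow> B x = B' x"
    using ae_eqn_continuous_last[OF meas(3,4,1,2) ae' C' A'] .
  show ?thesis
    using that[OF A'(1) B'(1) C'(1) D'(1) B'(2) D'(2)
        eqn_of_ae_eqn[OF ae A'(1) B'(1) C'(1) D'(1) A'(2) B'(2) C'(2) D'(2)]] .
qed

section \<open>From continuous to twice differentiable solutions\<close>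

definition once_diff :: "(real \<Rightarrow> real) \<Rightarrow> bool" where
  "once_diff f \<longleftrightarrow> (\<exists>f1. \<forall>x>0. (f has_real_derivative f1 x) (at x))"

text \<open>The second derivative may be discontinuous: the final integration only uses that a
  vanishing derivative forces a constant.\<close>

definition twice_diff :: "(real \<Rightarrow> real) \<Rightarrow> bool" where
  "twice_diff f \<longleftrightarrow> (\<exists>f1 f2. \<forall>x>0. (f has_real_derivative f1 x) (at x) \<and>
     (f1 has_real_derivative f2 x) (at x))"

lemma DERIV_cong_pos:
  fixes f g :: "real \<Rightarrow> real"
  assumes "(f has_real_derivative d) (at x)" "0 < x" "\<And>x. 0 < x \<Longrightarrow> f x = g x"
  shows "(g has_real_derivative d) (at x)"
  using has_field_derivative_transform_within_open[OF assms(1), of "{0<..}"] assms(2,3) by auto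

lemma once_diffI:
  assumes "\<And>x. 0 < x \<Longrightarrow> g differentiable (at x)" "\<And>x. 0 < x \<Longrightarrow> g x = f x"
  shows "once_diff f"
proof -
  have "\<exists>d. (f has_real_derivative d) (at x)" if "0 < x" for x
    using assms(1)[OF that] DERIV_cong_pos[of g _ x f, OF _ that assms(2)]
    by (auto simp: real_differentiable_def)
  thus ?thesis unfolding once_diff_def by metis
qed

lemma twice_diffI:
  assumes "\<And>x. 0 < x \<Longrightarrow> (f has_real_derivative f1 x) (at x)"
    and "\<And>x. 0 < x \<Longrightarrow> f1 differentiable (at x)"
  shows "twice_diff f"
  unfolding twice_diff_def using assms by (metis real_differentiable_def)

lemma differentiable_comp_pos:
  fixes f g :: "real \<Rightarrow> real"
  assumes "\<And>x. 0 < x \<Longrightarrow> (f has_real_derivative f1 x) (at x)" "g differentiable (at x)" "0 < g x"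
  shows "(\<lambda>x. f (g x)) differentiable (at x)"
  using assms(2) DERIV_chain2[where f = f and g = g and x = x, OF assms(1)[OF assms(3)]]
  by (auto simp: real_differentiable_def)

text \<open>\<open>C\<close> enters only through its average \<open>K\<close>, so raising the
  regularity of \<open>A\<close> demands nothing further of \<open>C\<close>.\<close>

lemma eqn_integral_form:
  assumes eq: "eqn A B C D"
    and c: "continuous_on {0<..} B" "continuous_on {0<..} C" "continuous_on {0<..} D"
  obtains K FB FD where
    "\<And>x. 0 < x \<Longrightarrow> (FB has_real_derivative B x) (at x)"
    "\<And>x. 0 < x \<Longrightarrow> (FD has_real_derivative D x) (at x)"
    "\<And>x. 0 < x \<Longrightarrow> A x = K + (FD (3 * x) - FD (2 * x)) / x
     - (FB (2 * (1 + x)) - FB (1 + x)) / (1 + x)"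
proof -
  note li = loc_int_continuous[OF c(1)] loc_int_continuous[OF c(2)] loc_int_continuous[OF c(3)]
  obtain FB where FB: "\<And>s t. 0 < s \<Longrightarrow> s \<le> t \<Longrightarrow> integral {s..t} B = FB t - FB s"
    "\<And>x. 0 < x \<Longrightarrow> (FB has_real_derivative B x) (at x)"
    using antiderivative_exists[OF li(1)] c(1) by metis
  obtain FD where FD: "\<And>s t. 0 < s \<Longrightarrow> s \<le> t \<Longrightarrow> integral {s..t} D = FD t - FD s"
    "\<And>x. 0 < x \<Longrightarrow> (FD has_real_derivative D x) (at x)"
    using antiderivative_exists[OF li(3)] c(3) by metis
  have "A x = integral {1..2} C + (FD (3 * x) - FD (2 * x)) / x
     - (FB (2 * (1 + x)) - FB (1 + x)) / (1 + x)" if "0 < x" for x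
    using eq that unfolding eqn_def
    by (intro averaged_eqn[OF li(1) FB(1) li(3) FD(1) li(2)]) auto
  with FB(2) FD(2) show ?thesis by (rule that)
qed

lemma eqn_first_once_diff:
  assumes eq: "eqn A B C D"
    and c: "continuous_on {0<..} B" "continuous_on {0<..} C" "continuous_on {0<..} D"
  shows "once_diff A"
proof -
  obtain K FB FD where FB: "\<And>x. 0 < x \<Longrightarrow> (FB has_real_derivative B x) (at x)"
    and FD: "\<And>x. 0 < x \<Longrightarrow> (FD has_real_derivative D x) (at x)"
    and A: "\<And>x. 0 < x \<Longrightarrow> A x = K + (FD (3 * x) - FD (2 * x)) / x
     - (FB (2 * (1 + x)) - FB (1 + x)) / (1 + x)"
    using eqn_integral_form[OF eq c] by metis
  show ?thesis
  proof (rule once_diffI)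
    fix x :: real assume x: "0 < x"
    show "(\<lambda>x. K + (FD (3 * x) - FD (2 * x)) / x
     - (FB (2 * (1 + x)) - FB (1 + x)) / (1 + x)) differentiable (at x)"
      using x by (intro derivative_intros differentiable_comp_pos[OF FB] differentiable_comp_pos[OF FD]) auto
  qed (simp add: A)
qed

lemma once_diff_continuous: "once_diff f \<Longrightarrow> continuous_on {0<..} f"
  unfolding once_diff_def
  by (metis DERIV_isCont continuous_at_imp_continuous_on greaterThan_iff)

text \<open>The derivative of the averaged formula involves only \<open>FB\<close>,
  \<open>FD\<close>, \<open>B\<close> and \<open>D\<close>, all differentiable at this
  stage.\<close>

lemma eqn_first_twice_diff:
  assumes eq: "eqn A B C D" and d: "once_diff B" "continuous_on {0<..} C" "once_diff D"
  shows "twice_diff A"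
proof -
  obtain K FB FD where FB: "\<And>x. 0 < x \<Longrightarrow> (FB has_real_derivative B x) (at x)"
    and FD: "\<And>x. 0 < x \<Longrightarrow> (FD has_real_derivative D x) (at x)"
    and A: "\<And>x. 0 < x \<Longrightarrow> A x = K + (FD (3 * x) - FD (2 * x)) / x
     - (FB (2 * (1 + x)) - FB (1 + x)) / (1 + x)"
    using eqn_integral_form[OF eq once_diff_continuous[OF d(1)] d(2) once_diff_continuous[OF d(3)]] by metis
  obtain B1 where B1: "\<And>x. 0 < x \<Longrightarrow> (B has_real_derivative B1 x) (at x)"
    using d(1) unfolding once_diff_def by blast
  obtain D1 where D1: "\<And>x. 0 < x \<Longrightarrow> (D has_real_derivative D1 x) (at x)"
    using d(3) unfolding once_diff_def by blast
  show ?thesis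
  proof (rule twice_diffI)
    fix x :: real assume x: "0 < x"
    have "((\<lambda>x. K + (FD (3 * x) - FD (2 * x)) / x
       - (FB (2 * (1 + x)) - FB (1 + x)) / (1 + x)) has_real_derivative
        ((3 * D (3 * x) - 2 * D (2 * x)) * x - (FD (3 * x) - FD (2 * x))) / (x * x)
       - ((2 * B (2 * (1 + x)) - B (1 + x)) * (1 + x) - (FB (2 * (1 + x)) - FB (1 + x)))
           / ((1 + x) * (1 + x))) (at x)"
      using x by (auto intro!: derivative_eq_intros DERIV_chain2[OF FB] DERIV_chain2[OF FD]
          simp: mult.commute[of _ 2] mult.commute[of _ 3])
    thus "(A has_real_derivative
        ((3 * D (3 * x) - 2 * D (2 * x)) * x - (FD (3 * x) - FD (2 * x))) / (x * x)
       - ((2 * B (2 * (1 + x)) - B (1 + x)) * (1 + x) - (FB (2 * (1 + x)) - FB (1 + x)))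
           / ((1 + x) * (1 + x))) (at x)"
      by (rule DERIV_cong_pos) (use x A in auto)
    show "(\<lambda>x. ((3 * D (3 * x) - 2 * D (2 * x)) * x - (FD (3 * x) - FD (2 * x))) / (x * x)
       - ((2 * B (2 * (1 + x)) - B (1 + x)) * (1 + x) - (FB (2 * (1 + x)) - FB (1 + x)))
           / ((1 + x) * (1 + x))) differentiable (at x)"
      using x by (intro derivative_intros differentiable_comp_pos[OF FB] differentiable_comp_pos[OF FD]
          differentiable_comp_pos[OF B1] differentiable_comp_pos[OF D1]) auto
  qed
qed

text \<open>For \<open>y = 1\<close> the discriminant reduces to \<open>v * v + 4\<close>, hence the
  choice of this curve below.\<close>

lemma y_curve_1_DERIV:
  assumes "0 < v"
  shows "(y_curve 1 has_real_derivative (1 + v / sqrt (v * v + 4)) / 2) (at v)"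
proof -
  have "(v - 1 - 1)\<^sup>2 + 4 * v = v * v + 4" by (simp add: power2_eq_square algebra_simps)
  thus ?thesis using y_curve_DERIV[OF assms, of 1] by simp
qed

text \<open>On the curve with \<open>y = 1\<close>, \<open>B\<close> enters only through the
  constant \<open>B 1\<close>.\<close>

lemma eqn_last_once_diff:
  assumes eq: "eqn A B C D" and d: "once_diff A" "once_diff C"
  shows "once_diff D"
proof -
  obtain A1 where A1: "\<And>x. 0 < x \<Longrightarrow> (A has_real_derivative A1 x) (at x)"
    using d(1) unfolding once_diff_def by blast
  obtain C1 where C1: "\<And>x. 0 < x \<Longrightarrow> (C has_real_derivative C1 x) (at x)"
    using d(2) unfolding once_diff_def by blast
  show ?thesis
  proof (rule once_diffI)
    fix v :: real assume v: "0 < v"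
    have p: "0 < y_curve 1 v" "0 < 1 + y_curve 1 v" "1 + y_curve 1 v \<noteq> 0"
      using y_curve_pos[OF v, of 1] by auto
    have "y_curve 1 differentiable (at v)"
      using y_curve_1_DERIV[OF v] by (auto simp: real_differentiable_def)
    thus "(\<lambda>v. A (y_curve 1 v) + B 1 - C (1 / (1 + y_curve 1 v))) differentiable (at v)"
      using v p by (intro derivative_intros differentiable_comp_pos[OF A1] differentiable_comp_pos[OF C1]) auto
  qed (simp add: eqn_along_curve[OF eq _ zero_less_one])
qed

lemma eqn_last_twice_diff:
  assumes eq: "eqn A B C D" and d: "twice_diff A" "twice_diff C"
  shows "twice_diff D"
proof -
  obtain A1 A2 where A: "\<And>x. 0 < x \<Longrightarrow> (A has_real_derivative A1 x) (at x)"
    "\<And>x. 0 < x \<Longrightarrow> (A1 has_real_derivative A2 x) (at x)"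
    using d(1) unfolding twice_diff_def by blast
  obtain C1 C2 where C: "\<And>x. 0 < x \<Longrightarrow> (C has_real_derivative C1 x) (at x)"
    "\<And>x. 0 < x \<Longrightarrow> (C1 has_real_derivative C2 x) (at x)"
    using d(2) unfolding twice_diff_def by blast
  define g1 where "g1 v = (1 + v / sqrt (v * v + 4)) / 2" for v :: real
  have g1: "(y_curve 1 has_real_derivative g1 v) (at v)" if "0 < v" for v
    using y_curve_1_DERIV[OF that] by (simp add: g1_def)
  \<comment> \<open>Differentiating \<open>D\<close> twice also takes the second derivative of the
    curve.\<close>
  have g2: "g1 differentiable (at v)" if "0 < v" for v
  proof -
    have "0 < v * v + 4" using that by (simp add: add_pos_pos)
    thus ?thesis unfolding g1_def [abs_def]
      by (intro derivative_intros differentiable_comp_pos[OF DERIV_real_sqrt]) auto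
  qed
  show ?thesis
  proof (rule twice_diffI)
    fix v :: real assume v: "0 < v"
    have p: "0 < y_curve 1 v" "0 < 1 + y_curve 1 v" "1 + y_curve 1 v \<noteq> 0"
      using y_curve_pos[OF v, of 1] by auto
    have "((\<lambda>v. A (y_curve 1 v) + B 1 - C (1 / (1 + y_curve 1 v))) has_real_derivative
        A1 (y_curve 1 v) * g1 v + C1 (1 / (1 + y_curve 1 v)) * (g1 v / ((1 + y_curve 1 v) * (1 + y_curve 1 v)))) (at v)"
      using v p by (auto intro!: derivative_eq_intros DERIV_chain2[OF A(1)] DERIV_chain2[OF C(1)] g1)
    thus "(D has_real_derivative
        A1 (y_curve 1 v) * g1 v + C1 (1 / (1 + y_curve 1 v)) * (g1 v / ((1 + y_curve 1 v) * (1 + y_curve 1 v)))) (at v)"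
      by (rule DERIV_cong_pos) (use v eqn_along_curve[OF eq _ zero_less_one] in auto)
    have "y_curve 1 differentiable (at v)"
      using g1[OF v] by (auto simp: real_differentiable_def)
    thus "(\<lambda>v. A1 (y_curve 1 v) * g1 v
        + C1 (1 / (1 + y_curve 1 v)) * (g1 v / ((1 + y_curve 1 v) * (1 + y_curve 1 v)))) differentiable (at v)"
      using v p by (intro derivative_intros differentiable_comp_pos[OF A(2)] differentiable_comp_pos[OF C(2)] g2) auto
  qed
qed

text \<open>Bootstrapping in alternation: averaging improves \<open>A\<close> and \<open>C\<close>,
  the curve passes the gain on to \<open>D\<close> and \<open>B\<close>, and a second round yields
  the second derivatives.\<close>

lemma eqn_smooth:
  assumes eq: "eqn A B C D"
    and c: "continuous_on {0<..} A" "continuous_on {0<..} B" "continuous_on {0<..} C" "continuous_on {0<..} D"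
  shows "once_diff A" "twice_diff B" "twice_diff D"
proof -
  note eq' = eqn_swap[OF eq]
  have A: "once_diff A" by (rule eqn_first_once_diff[OF eq c(2,3,4)])
  have C: "once_diff C" by (rule eqn_first_once_diff[OF eq' c(4,1,2)])
  have D: "once_diff D" by (rule eqn_last_once_diff[OF eq A C])
  have B: "once_diff B" by (rule eqn_last_once_diff[OF eq' C A])
  have A2: "twice_diff A" by (rule eqn_first_twice_diff[OF eq B c(3) D])
  have C2: "twice_diff C" by (rule eqn_first_twice_diff[OF eq' D c(1) B])
  show "once_diff A" "twice_diff B" "twice_diff D"
    using A eqn_last_twice_diff[OF eq A2 C2] eqn_last_twice_diff[OF eq' C2 A2] by auto
qed

section \<open>The smooth solutions\<close>

text \<open>The left side of the equation is the derivative of \<open>x * f1 x\<close>; integrating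
  once gives \<open>x * f1 x + c * x = \<alpha>\<close>, and dividing by \<open>x\<close> and
  integrating again gives the logarithm.\<close>

lemma log_linear_of_ode:
  fixes f :: "real \<Rightarrow> real"
  assumes f: "\<And>x. 0 < x \<Longrightarrow> (f has_real_derivative f1 x) (at x)"
    and f1: "\<And>x. 0 < x \<Longrightarrow> (f1 has_real_derivative f2 x) (at x)"
    and ode: "\<And>x. 0 < x \<Longrightarrow> f1 x + x * f2 x = - c"
  obtains \<alpha> k where "\<And>x. 0 < x \<Longrightarrow> f x = \<alpha> * ln x - c * x + k"
proof -
  have "\<exists>\<alpha>. \<forall>x\<in>{0<..}. x * f1 x + c * x = \<alpha>"
  proof (rule has_field_derivative_zero_constant)
    fix x :: real assume "x \<in> {0<..}"
    hence "((\<lambda>x. x * f1 x + c * x) has_real_derivative 0) (at x)"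
      using ode[of x] by (auto intro!: derivative_eq_intros f1 simp: algebra_simps)
    thus "((\<lambda>x. x * f1 x + c * x) has_real_derivative 0) (at x within {0<..})"
      by (rule has_field_derivative_at_within)
  qed simp
  then obtain \<alpha> where \<alpha>: "\<And>x. 0 < x \<Longrightarrow> x * f1 x + c * x = \<alpha>" by auto
  have "\<exists>k. \<forall>x\<in>{0<..}. f x - \<alpha> * ln x + c * x = k"
  proof (rule has_field_derivative_zero_constant)
    fix x :: real assume "x \<in> {0<..}"
    hence "((\<lambda>x. f x - \<alpha> * ln x + c * x) has_real_derivative 0) (at x)"
      using \<alpha>[of x] by (auto intro!: derivative_eq_intros f simp: field_simps)
    thus "((\<lambda>x. f x - \<alpha> * ln x + c * x) has_real_derivative 0) (at x within {0<..})"
      by (rule has_field_derivative_at_within)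
  qed simp
  then obtain k where "\<And>x. 0 < x \<Longrightarrow> f x - \<alpha> * ln x + c * x = k" by auto
  with that[of \<alpha> k] show ?thesis by (smt (verit))
qed

lemma eqn_solution:
  assumes eq: "eqn A B C D"
    and c: "continuous_on {0<..} A" "continuous_on {0<..} B" "continuous_on {0<..} C" "continuous_on {0<..} D"
  obtains \<beta> \<gamma> k \<alpha> l where "\<forall>y>0. B y = \<beta> * ln y - \<gamma> * y + k"
    "\<forall>v>0. D v = \<alpha> * ln v - \<gamma> * v + l"
proof -
  obtain A1 where A: "\<And>x. 0 < x \<Longrightarrow> (A has_real_derivative A1 x) (at x)"
    using eqn_smooth(1)[OF eq c] unfolding once_diff_def by blast
  obtain B1 B2 where B: "\<And>x. 0 < x \<Longrightarrow> (B has_real_derivative B1 x) (at x)"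
    "\<And>x. 0 < x \<Longrightarrow> (B1 has_real_derivative B2 x) (at x)"
    using eqn_smooth(2)[OF eq c] unfolding twice_diff_def by blast
  obtain D1 D2 where D: "\<And>x. 0 < x \<Longrightarrow> (D has_real_derivative D1 x) (at x)"
    "\<And>x. 0 < x \<Longrightarrow> (D1 has_real_derivative D2 x) (at x)"
    using eqn_smooth(3)[OF eq c] unfolding twice_diff_def by blast
  \<comment> \<open>Differentiating in \<open>x\<close> eliminates \<open>C\<close>.\<close>
  have dx: "A1 x + u * B1 (u * (1 + x)) = (1 + u) * D1 (x * (1 + u))" if x: "0 < x" and u: "0 < u" for x u
  proof -
    have "((\<lambda>x. A x + B (u * (1 + x))) has_real_derivative A1 x + B1 (u * (1 + x)) * u) (at x)"
      using x u by (auto intro!: derivative_eq_intros A DERIV_chain2[OF B(1)])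
    moreover have "((\<lambda>x. A x + B (u * (1 + x))) has_real_derivative D1 (x * (1 + u)) * (1 + u)) (at x)"
    proof (rule DERIV_cong_pos)
      show "((\<lambda>x. C u + D (x * (1 + u))) has_real_derivative D1 (x * (1 + u)) * (1 + u)) (at x)"
        using x u by (auto intro!: derivative_eq_intros DERIV_chain2[OF D(1)])
    qed (use eq x u in \<open>auto simp: eqn_def\<close>)
    ultimately show ?thesis using DERIV_unique by (fastforce simp: mult.commute)
  qed
  \<comment> \<open>Differentiating in \<open>u\<close> eliminates \<open>A1\<close>.\<close>
  have dxu: "B1 (u * (1 + x)) + u * (1 + x) * B2 (u * (1 + x)) = D1 (x * (1 + u)) + x * (1 + u) * D2 (x * (1 + u))"
    if x: "0 < x" and u: "0 < u" for x u
  proof -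
    have "((\<lambda>u. A1 x + u * B1 (u * (1 + x))) has_real_derivative
        B1 (u * (1 + x)) + B2 (u * (1 + x)) * (1 + x) * u) (at u)"
      using x u by (auto intro!: derivative_eq_intros DERIV_chain2[OF B(2)])
    moreover have "((\<lambda>u. A1 x + u * B1 (u * (1 + x))) has_real_derivative
        D1 (x * (1 + u)) + D2 (x * (1 + u)) * x * (1 + u)) (at u)"
    proof (rule DERIV_cong_pos)
      show "((\<lambda>u. (1 + u) * D1 (x * (1 + u))) has_real_derivative
          D1 (x * (1 + u)) + D2 (x * (1 + u)) * x * (1 + u)) (at u)"
        using x u by (auto intro!: derivative_eq_intros DERIV_chain2[OF D(2)])
    qed (use dx x u in auto)
    ultimately have "B1 (u * (1 + x)) + B2 (u * (1 + x)) * (1 + x) * u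
        = D1 (x * (1 + u)) + D2 (x * (1 + u)) * x * (1 + u)"
      by (rule DERIV_unique)
    thus ?thesis by (simp add: ac_simps)
  qed
  \<comment> \<open>Every pair of positive \<open>y\<close> and \<open>v\<close> is reached by some
    \<open>x\<close> and \<open>u\<close>, so the two sides vary independently.\<close>
  have const: "B1 y + y * B2 y = D1 v + v * D2 v" if y: "0 < y" and v: "0 < v" for y v
    using dxu[of "y_curve y v" "y / (1 + y_curve y v)"] y_curve_pos[OF v, of y] y_curve_eq[OF v, of y] y
    by simp
  define \<gamma> where "\<gamma> = - (B1 1 + B2 1)"
  have D\<gamma>: "D1 v + v * D2 v = - \<gamma>" if "0 < v" for v using const[of 1 v] that by (simp add: \<gamma>_def)
  have B\<gamma>: "B1 y + y * B2 y = - \<gamma>" if "0 < y" for y using const[of y 1] D\<gamma>[of 1] that by simp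
  obtain \<beta> k where B': "\<And>y. 0 < y \<Longrightarrow> B y = \<beta> * ln y - \<gamma> * y + k"
    using log_linear_of_ode[OF B B\<gamma>] by metis
  obtain \<alpha> l where D': "\<And>v. 0 < v \<Longrightarrow> D v = \<alpha> * ln v - \<gamma> * v + l"
    using log_linear_of_ode[OF D D\<gamma>] by metis
  show ?thesis by (rule that[of \<beta> \<gamma> k \<alpha> l]) (simp_all add: B' D')
qed

lemma ae_eqn_solution:
  assumes meas: "A \<in> borel_measurable borel" "B \<in> borel_measurable borel"
    "C \<in> borel_measurable borel" "D \<in> borel_measurable borel"
    and ae: "ae_eqn A B C D"
    and li: "loc_int A" "loc_int B" "loc_int C" "loc_int D"
  obtains \<beta> \<gamma> k \<alpha> l where
    "AE y in lborel. 0 < y \<longrightarrow> B y = \<beta> * ln y - \<gamma> * y + k"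
    "AE v in lborel. 0 < v \<longrightarrow> D v = \<alpha> * ln v - \<gamma> * v + l"
proof -
  obtain A' B' C' D' where
    c: "continuous_on {0<..} A'" "continuous_on {0<..} B'" "continuous_on {0<..} C'" "continuous_on {0<..} D'"
    and B': "AE x in lborel. 0 < x \<longrightarrow> B x = B' x"
    and D': "AE x in lborel. 0 < x \<longrightarrow> D x = D' x" and eq: "eqn A' B' C' D'"
    using ae_eqn_continuous[OF meas ae li] .
  obtain \<beta> \<gamma> k \<alpha> l where *: "\<forall>y>0. B' y = \<beta> * ln y - \<gamma> * y + k"
    "\<forall>v>0. D' v = \<alpha> * ln v - \<gamma> * v + l"
    using eqn_solution[OF eq c] .
  show ?thesis
  proof (rule that)
    show "AE y in lborel. 0 < y \<longrightarrow> B y = \<beta> * ln y - \<gamma> * y + k"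
      using B' by eventually_elim (simp add: *)
    show "AE v in lborel. 0 < v \<longrightarrow> D v = \<alpha> * ln v - \<gamma> * v + l"
      using D' by eventually_elim (simp add: *)
  qed
qed

section \<open>Multiplicative form of the equation\<close>

text \<open>Both sides are the density of \<open>(X, U)\<close> at \<open>(x, u)\<close>, since \<open>Y = U * (1 + X)\<close> and
  \<open>V = X * (1 + U)\<close>; here \<open>f, g, h, k\<close> are the densities of \<open>X, Y, U, V\<close>.\<close>

definition prod_eqn :: "(real \<Rightarrow> real) \<Rightarrow> (real \<Rightarrow> real) \<Rightarrow> (real \<Rightarrow> real) \<Rightarrow> (real \<Rightarrow> real) \<Rightarrow> bool" where
  "prod_eqn f g h k \<longleftrightarrow>
     (AE x in lborel. AE u in lborel. 0 < x \<longrightarrow> 0 < u \<longrightarrow>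
        (1 + x) * f x * g (u * (1 + x)) = (1 + u) * h u * k (x * (1 + u)))"

text \<open>The constant is arbitrary; for a density, total mass one later fixes it. The negative
  half-line is left out, since the densities in question vanish there almost everywhere.\<close>

definition proportional :: "(real \<Rightarrow> real) \<Rightarrow> (real \<Rightarrow> real) \<Rightarrow> bool" where
  "proportional f q \<longleftrightarrow> (\<exists>\<kappa>. AE x in lborel. 0 < x \<longrightarrow> f x = \<kappa> * q x)"

text \<open>Positivity of the densities of \<open>U\<close> and \<open>V\<close> is derived from the
  product equation, which can give it only almost everywhere.\<close>

definition ae_pos :: "(real \<Rightarrow> real) \<Rightarrow> bool" where
  "ae_pos f \<longleftrightarrow> (AE x in lborel. 0 < x \<longrightarrow> 0 < f x)"

lemma prod_eqn_swap:
  assumes [measurable]: "f \<in> borel_measurable borel" "g \<in> borel_measurable borel"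
    "h \<in> borel_measurable borel" "k \<in> borel_measurable borel"
    and ae: "prod_eqn f g h k"
  shows "prod_eqn h k f g"
proof -
  have "AE u in lborel. AE x in lborel. 0 < x \<longrightarrow> 0 < u \<longrightarrow>
      (1 + x) * f x * g (u * (1 + x)) = (1 + u) * h u * k (x * (1 + u))"
    using ae unfolding prod_eqn_def by (rule AE_lborel_commute[rotated]) measurable
  thus ?thesis unfolding prod_eqn_def
  proof eventually_elim
    case (elim u)
    thus ?case by eventually_elim auto
  qed
qed

lemma AE_pos_shift_scale:
  fixes P :: "real \<Rightarrow> bool"
  assumes "AE v in lborel. 0 < v \<longrightarrow> P v" and c: "0 < c"
  shows "AE x in lborel. 0 < x \<longrightarrow> P (c * (1 + x))"
proof (rule AE_pos_comp[OF assms(1), where g = "\<lambda>v. v / c - 1"])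
  show "(\<lambda>v. v / c - 1) differentiable_on {0<..}"
    using c by (intro differentiable_on_posI derivative_intros) auto
qed (use c in auto)

text \<open>For one good \<open>x\<close> the left side is positive for almost every
  \<open>u\<close>, so \<open>h u\<close> cannot vanish.\<close>

lemma prod_eqn_ae_pos:
  assumes ae: "prod_eqn f g h k" and nonneg: "\<And>x. 0 \<le> h x" "\<And>x. 0 \<le> k x"
    and f: "ae_pos f" and g: "ae_pos g"
  shows "ae_pos h"
proof -
  have "AE x::real in lborel. 0 < x \<longrightarrow> (AE u in lborel. 0 < u \<longrightarrow> 0 < h u)"
    using ae[unfolded prod_eqn_def] f[unfolded ae_pos_def]
  proof eventually_elim
    case (elim x)
    show ?case
    proof
      assume x: "0 < x"
      have "AE u in lborel. 0 < u \<longrightarrow> 0 < g ((1 + x) * u)"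
        using AE_pos_scale[OF g[unfolded ae_pos_def], of "1 + x"] x by simp
      with elim(1) show "AE u in lborel. 0 < u \<longrightarrow> 0 < h u"
      proof eventually_elim
        case (elim u)
        show ?case
        proof
          assume u: "0 < u"
          have "0 < f x" "0 < g (u * (1 + x))"
            using x u elim(2) \<open>0 < x \<longrightarrow> 0 < f x\<close> by (simp_all add: mult.commute)
          hence "0 < (1 + x) * f x * g (u * (1 + x))" using x by simp
          also have "\<dots> = (1 + u) * h u * k (x * (1 + u))" using elim x u by blast
          finally have "h u \<noteq> 0" by auto
          with nonneg(1)[of u] show "0 < h u" by simp
        qed
      qed
    qed
  qed
  then obtain x :: real where "AE u in lborel. 0 < u \<longrightarrow> 0 < h u" by (rule AE_pos_obtain)
  thus ?thesis unfolding ae_pos_def .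
qed

text \<open>Here \<open>u\<close> is fixed instead, and \<open>x * (1 + u)\<close> sweeps the
  half-line; the swapped form of the equation has \<open>u\<close> as its outer variable.\<close>

lemma ae_pos_last:
  assumes ae: "prod_eqn h k f g" and nonneg: "\<And>x. 0 \<le> h x" "\<And>x. 0 \<le> k x"
    and f: "ae_pos f" and g: "ae_pos g"
  shows "ae_pos k"
proof -
  have "AE u::real in lborel. 0 < u \<longrightarrow> (AE v in lborel. 0 < v \<longrightarrow> 0 < k v)"
    using ae[unfolded prod_eqn_def]
  proof eventually_elim
    case (elim u)
    show ?case
    proof
      assume u: "0 < u"
      have "AE x in lborel. 0 < x \<longrightarrow> 0 < g (u * (1 + x))"
        using AE_pos_shift_scale[OF g[unfolded ae_pos_def] u] .
      with elim f[unfolded ae_pos_def] have "AE x in lborel. 0 < x \<longrightarrow> 0 < k ((1 + u) * x)"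
      proof eventually_elim
        case (elim x)
        show ?case
        proof
          assume x: "0 < x"
          have "0 < f x" "0 < g (u * (1 + x))" using x elim(2,3) by simp_all
          hence "0 < (1 + x) * f x * g (u * (1 + x))" using x by simp
          also have "\<dots> = (1 + u) * h u * k (x * (1 + u))" using elim x u by simp
          finally have "k (x * (1 + u)) \<noteq> 0" by auto
          with nonneg(2)[of "x * (1 + u)"] show "0 < k ((1 + u) * x)" by (simp add: mult.commute)
        qed
      qed
      from AE_pos_scale[OF this, of "1 / (1 + u)"] u show "AE v in lborel. 0 < v \<longrightarrow> 0 < k v" by simp
    qed
  qed
  then obtain u :: real where "AE v in lborel. 0 < v \<longrightarrow> 0 < k v" by (rule AE_pos_obtain)
  thus ?thesis unfolding ae_pos_def .
qed

text \<open>The primed functions form a reference solution. Dividing the two equations at a fixed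
  \<open>u\<close> shows that \<open>f x / f' x\<close> does not depend on \<open>x\<close>.\<close>

lemma proportional_first:
  assumes ae: "prod_eqn h k f g"
    and eq': "\<And>x u. 0 < x \<Longrightarrow> 0 < u \<Longrightarrow>
        (1 + x) * f' x * g' (u * (1 + x)) = (1 + u) * h' u * k' (x * (1 + u))"
    and pos': "\<And>x. 0 < x \<Longrightarrow> 0 < g' x" "\<And>x. 0 < x \<Longrightarrow> 0 < h' x"
    and g: "ae_pos g" and pg: "proportional g g'" and pk: "proportional k k'"
  shows "proportional f f'"
proof -
  obtain b where b: "AE y in lborel. 0 < y \<longrightarrow> g y = b * g' y" using pg unfolding proportional_def by blast
  obtain d where d: "AE v in lborel. 0 < v \<longrightarrow> k v = d * k' v" using pk unfolding proportional_def by blast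
  \<comment> \<open>With \<open>b = 0\<close> the function \<open>g\<close> would vanish almost
    everywhere.\<close>
  have "AE y::real in lborel. 0 < y \<longrightarrow> b \<noteq> 0"
    using b g[unfolded ae_pos_def] by eventually_elim auto
  then obtain y :: real where b0: "b \<noteq> 0" by (rule AE_pos_obtain)
  have "AE u::real in lborel. 0 < u \<longrightarrow> proportional f f'"
    using ae[unfolded prod_eqn_def]
  proof eventually_elim
    case (elim u)
    show ?case
    proof
      assume u: "0 < u"
      have "AE x in lborel. 0 < x \<longrightarrow> k ((1 + u) * x) = d * k' ((1 + u) * x)"
        using AE_pos_scale[OF d, of "1 + u"] u by simp
      with elim AE_pos_shift_scale[OF b u]
      have "AE x in lborel. 0 < x \<longrightarrow> f x = (h u * d / (b * h' u)) * f' x"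
      proof eventually_elim
        case (elim x)
        show ?case
        proof
          assume x: "0 < x"
          let ?G = "g' (u * (1 + x))" and ?K = "k' (x * (1 + u))"
          have G: "0 < ?G" using pos'(1) x u by simp
          have "(1 + x) * f x * (b * ?G) = (1 + u) * h u * (d * ?K)"
            using elim x u by (simp add: mult.commute)
          hence "h' u * ((1 + x) * f x * (b * ?G)) = h u * d * ((1 + u) * h' u * ?K)"
            by (simp only: ac_simps)
          also have "\<dots> = h u * d * ((1 + x) * f' x * ?G)" using eq'[OF x u] by simp
          finally have "((1 + x) * ?G) * (b * h' u * f x) = ((1 + x) * ?G) * (h u * d * f' x)"
            by (simp only: ac_simps)
          hence "b * h' u * f x = h u * d * f' x" using x G by simp
          thus "f x = (h u * d / (b * h' u)) * f' x"
            using b0 pos'(2)[OF u] by (simp add: field_simps)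
        qed
      qed
      thus "proportional f f'" unfolding proportional_def by blast
    qed
  qed
  thus ?thesis by (rule AE_pos_obtain)
qed

text \<open>The same comparison at a fixed \<open>u\<close>, now solved for the ratio of
  \<open>k\<close> and \<open>k'\<close>, with \<open>v = (1 + u) * x\<close> as the free
  variable.\<close>

lemma proportional_last:
  assumes ae: "prod_eqn h k f g"
    and eq': "\<And>x u. 0 < x \<Longrightarrow> 0 < u \<Longrightarrow>
        (1 + x) * f' x * g' (u * (1 + x)) = (1 + u) * h' u * k' (x * (1 + u))"
    and h: "ae_pos h" and pf: "proportional f f'" and pg: "proportional g g'"
  shows "proportional k k'"
proof -
  obtain a where a: "AE x in lborel. 0 < x \<longrightarrow> f x = a * f' x" using pf unfolding proportional_def by blast
  obtain b where b: "AE y in lborel. 0 < y \<longrightarrow> g y = b * g' y" using pg unfolding proportional_def by blast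
  have "AE u::real in lborel. 0 < u \<longrightarrow> proportional k k'"
    using ae[unfolded prod_eqn_def] h[unfolded ae_pos_def]
  proof eventually_elim
    case (elim u)
    show ?case
    proof
      assume u: "0 < u"
      hence hu: "0 < h u" using elim by blast
      from elim(1) AE_pos_shift_scale[OF b u] a
      have "AE x in lborel. 0 < x \<longrightarrow> k ((1 + u) * x) = (a * b * h' u / h u) * k' ((1 + u) * x)"
      proof eventually_elim
        case (elim x)
        show ?case
        proof
          assume x: "0 < x"
          let ?G = "g' (u * (1 + x))" and ?K = "k' (x * (1 + u))"
          have "(1 + u) * h u * k (x * (1 + u)) = (1 + x) * (a * f' x) * (b * ?G)"
            using elim x u by simp
          also have "\<dots> = a * b * ((1 + x) * f' x * ?G)" by (simp only: ac_simps)
          also have "\<dots> = a * b * ((1 + u) * h' u * ?K)" using eq'[OF x u] by simp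
          finally have "(1 + u) * (h u * k (x * (1 + u))) = (1 + u) * (a * b * h' u * ?K)"
            by (simp only: ac_simps)
          hence "h u * k (x * (1 + u)) = a * b * h' u * ?K" using u by simp
          thus "k ((1 + u) * x) = (a * b * h' u / h u) * k' ((1 + u) * x)"
            using hu by (simp add: field_simps)
        qed
      qed
      from AE_pos_scale[OF this, of "1 / (1 + u)"] u
      have "AE v in lborel. 0 < v \<longrightarrow> k v = (a * b * h' u / h u) * k' v" by simp
      thus "proportional k k'" unfolding proportional_def by blast
    qed
  qed
  thus ?thesis by (rule AE_pos_obtain)
qed

section \<open>Product identity and integrability of the kernels\<close>

lemma kernel_identity:
  assumes "0 < x" "0 < u"
  shows "(1 + x) * kummer_kernel a (b - a) c x * gamma_kernel b c (u * (1 + x))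
    = (1 + u) * kummer_kernel b (a - b) c u * gamma_kernel a c (x * (1 + u))"
proof -
  \<comment> \<open>This right side is invariant under exchanging \<open>(x, a)\<close> with
    \<open>(u, b)\<close>, so a second instance treats the other side of the identity.\<close>
  have *: "(1 + x) * kummer_kernel a (b - a) c x * gamma_kernel b c (u * (1 + x))
      = x powr (a - 1) * u powr (b - 1) * exp (- c * (x + u + x * u))"
    if "0 < x" "0 < u" for x u a b
  proof -
    have "(1 + x) * ((1 + x) powr (b - 1) / (1 + x) powr b) = 1"
      using that by (simp add: powr_diff)
    moreover have "exp (- c * x) * exp (- c * (u * (1 + x))) = exp (- c * (x + u + x * u))"
      by (simp add: exp_add[symmetric] algebra_simps)
    moreover have "(1 + x) * kummer_kernel a (b - a) c x * gamma_kernel b c (u * (1 + x))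
      = ((1 + x) * ((1 + x) powr (b - 1) / (1 + x) powr b)) * x powr (a - 1) * u powr (b - 1)
        * (exp (- c * x) * exp (- c * (u * (1 + x))))"
      using that by (simp add: kummer_kernel_def gamma_kernel_def powr_mult)
    ultimately show ?thesis by simp
  qed
  show ?thesis using *[OF assms, of a b] *[OF assms(2,1), of b a] by (simp add: ac_simps)
qed

lemma kummer_kernel_pos: "0 < x \<Longrightarrow> 0 < kummer_kernel a b c x"
  by (simp add: kummer_kernel_def)

lemma gamma_kernel_pos: "0 < x \<Longrightarrow> 0 < gamma_kernel a c x"
  by (simp add: gamma_kernel_def)

lemma kummer_kernel_nonneg: "0 \<le> kummer_kernel a b c x"
  by (simp add: kummer_kernel_def)

lemma gamma_kernel_nonneg: "0 \<le> gamma_kernel a c x"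
  by (simp add: gamma_kernel_def)

lemma kummer_kernel_nonpos: "x \<le> 0 \<Longrightarrow> kummer_kernel a b c x = 0"
  by (simp add: kummer_kernel_def)

lemma gamma_kernel_nonpos: "x \<le> 0 \<Longrightarrow> gamma_kernel a c x = 0"
  by (simp add: gamma_kernel_def)

lemma kummer_kernel_measurable [measurable]: "kummer_kernel a b c \<in> borel_measurable borel"
  unfolding kummer_kernel_def [abs_def] by measurable

lemma gamma_kernel_measurable [measurable]: "gamma_kernel a c \<in> borel_measurable borel"
  unfolding gamma_kernel_def [abs_def] by measurable

text \<open>Used with \<open>s\<close> near 0 or \<open>t\<close> large, where the logarithm makes
  the bound exceed any given integral.\<close>

lemma integrable_dominating_inverse:
  fixes f :: "real \<Rightarrow> real"
  assumes f: "integrable lborel f" "\<And>x. 0 \<le> f x" and s: "0 < s" "s \<le> t"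
    and m: "\<And>x. s \<le> x \<Longrightarrow> x \<le> t \<Longrightarrow> m / x \<le> f x"
  shows "m * (ln t - ln s) \<le> integral UNIV f"
proof -
  have fU: "f integrable_on UNIV"
    using has_integral_integral_lborel[OF f(1)] by (auto simp: integrable_on_def)
  have f1: "f integrable_on {s..t}" using fU by (rule integrable_on_subinterval) auto
  have "((\<lambda>x. m / x) has_integral m * ln t - m * ln s) {s..t}"
    using s by (intro fundamental_theorem_of_calculus)
      (auto intro!: derivative_eq_intros simp: has_real_derivative_iff_has_vector_derivative[symmetric])
  hence "m * ln t - m * ln s \<le> integral {s..t} f"
    using f1 m by (intro has_integral_le[OF _ integrable_integral]) auto
  also have "\<dots> \<le> integral UNIV f"
    using f1 fU f(2) by (intro integral_subset_le) auto
  finally show ?thesis by (simp add: algebra_simps)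
qed

text \<open>If \<open>b \<le> 0\<close> the kernel dominates a multiple of \<open>1 / x\<close> near
  0; if \<open>b > 0\<close> and \<open>c \<le> 0\<close> it dominates \<open>1 / x\<close> beyond
  1.\<close>

lemma gamma_kernel_integrable_imp:
  assumes int: "integrable lborel (gamma_kernel b c)"
  shows "0 < b \<and> 0 < c"
proof (rule ccontr)
  assume neg: "\<not> (0 < b \<and> 0 < c)"
  let ?I = "integral UNIV (gamma_kernel b c)"
  note le = integrable_dominating_inverse[OF int gamma_kernel_nonneg]
  show False
  proof (cases "0 < b")
    case False
    \<comment> \<open>A lower bound of \<open>exp (- c * x)\<close> for \<open>x\<close> between 0
      and 1, whatever the sign of \<open>c\<close>.\<close>
    define m where "m = exp (- \<bar>c\<bar>)"
    \<comment> \<open>Chosen to make \<open>m * (ln 1 - ln s)\<close> equal to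
      \<open>\<bar>?I\<bar> + 1\<close>.\<close>
    define s where "s = exp (- (\<bar>?I\<bar> + 1) / m)"
    have m: "0 < m" by (simp add: m_def)
    have s: "0 < s" "s \<le> 1" using m by (auto simp: s_def intro!: divide_nonpos_pos)
    have "m * (ln 1 - ln s) \<le> ?I"
    proof (rule le[OF s])
      fix x :: real assume x: "s \<le> x" "x \<le> 1"
      hence x0: "0 < x" using s by simp
      have "x powr (-1) \<le> x powr (b - 1)"
        using x0 x(2) False by (intro powr_mono') auto
      hence 1: "1 / x \<le> x powr (b - 1)" using x0 by (simp add: powr_minus_divide)
      have "c * x \<le> \<bar>c\<bar> * 1" using x0 x(2) by (intro mult_mono) auto
      hence "m \<le> exp (- c * x)" by (simp add: m_def)
      with 1 have "(1 / x) * m \<le> x powr (b - 1) * exp (- c * x)"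
        using m x0 by (intro mult_mono) auto
      thus "m / x \<le> gamma_kernel b c x" using x0 by (simp add: gamma_kernel_def)
    qed
    moreover have "m * (ln 1 - ln s) = \<bar>?I\<bar> + 1" using m by (simp add: s_def)
    ultimately show False by linarith
  next
    case True
    with neg have c: "c \<le> 0" by simp
    define t where "t = exp (\<bar>?I\<bar> + 1)"
    have t: "1 \<le> t" by (simp add: t_def)
    have "1 * (ln t - ln 1) \<le> ?I"
    proof (rule le[OF zero_less_one t])
      fix x :: real assume x: "1 \<le> x"
      have "x powr (-1) \<le> x powr (b - 1)"
        using x True by (intro powr_mono) auto
      hence 1: "1 / x \<le> x powr (b - 1)" using x by (simp add: powr_minus_divide)
      have "c * x \<le> 0" using x c by (simp add: mult_nonpos_nonneg)
      hence "1 \<le> exp (- c * x)" by simp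
      with 1 have "(1 / x) * 1 \<le> x powr (b - 1) * exp (- c * x)"
        using x by (intro mult_mono) auto
      thus "1 / x \<le> gamma_kernel b c x" using x by (simp add: gamma_kernel_def)
    qed
    thus False by (simp add: t_def)
  qed
qed

section \<open>Densities\<close>

text \<open>\<open>Z\<close> is the quotient only almost everywhere, because the lemma is also
  applied to \<open>X = V / (1 + U)\<close>, which may fail on a null set.\<close>

lemma (in prob_space) distributed_quotient:
  fixes X Y Z :: "'a \<Rightarrow> real"
  assumes indep: "indep_var borel X borel Y"
    and X: "distributed M lborel X (\<lambda>x. ennreal (f x))" and f: "\<And>x. 0 \<le> f x"
    and Y: "distributed M lborel Y (\<lambda>x. ennreal (g x))" and g: "\<And>x. 0 \<le> g x"
    and X_pos: "AE \<omega> in M. 0 < X \<omega>"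
    and Z [measurable]: "random_variable borel Z" and Z_eq: "AE \<omega> in M. Z \<omega> = Y \<omega> / (1 + X \<omega>)"
  shows "distributed M (lborel \<Otimes>\<^sub>M lborel) (\<lambda>\<omega>. (X \<omega>, Z \<omega>))
     (\<lambda>(x, u). ennreal (indicator {0<..} x * ((1 + x) * f x * g (u * (1 + x)))))"
proof (rule distributed_jointI)
  have [measurable]: "f \<in> borel_measurable borel" "g \<in> borel_measurable borel"
    using distributed_real_measurable[OF _ X] distributed_real_measurable[OF _ Y] f g by auto
  have [measurable]: "random_variable borel X" "random_variable borel Y"
    using distributed_measurable[OF X] distributed_measurable[OF Y] by auto
  show "random_variable lborel X" "random_variable lborel Z" by simp_all
  show "(\<lambda>(x, u). ennreal (indicator {0<..} x * ((1 + x) * f x * g (u * (1 + x)))))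
      \<in> borel_measurable (lborel \<Otimes>\<^sub>M lborel)"
    by measurable
  have "indep_var lborel ((\<lambda>x. x) \<circ> X) lborel ((\<lambda>x. x) \<circ> Y)"
    using indep by (rule indep_var_compose) auto
  hence joint: "distributed M (lborel \<Otimes>\<^sub>M lborel) (\<lambda>\<omega>. (X \<omega>, Y \<omega>)) (\<lambda>(x, y). ennreal (f x) * ennreal (g y))"
    by (intro distributed_joint_indep[OF _ _ X Y] lborel.sigma_finite_measure_axioms) (simp add: comp_def)
  fix A B :: "real set" assume "A \<in> sets lborel" "B \<in> sets lborel"
  hence [measurable]: "A \<in> sets borel" "B \<in> sets borel" by simp_all
  let ?S = "{(x, y). 0 < x \<and> x \<in> A \<and> y / (1 + x) \<in> B} :: (real \<times> real) set"
  have S [measurable]: "?S \<in> sets (lborel \<Otimes>\<^sub>M lborel)"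
  proof -
    have "Measurable.pred (borel \<Otimes>\<^sub>M borel) (\<lambda>(x::real, y). 0 < x \<and> x \<in> A \<and> y / (1 + x) \<in> B)"
      by measurable
    moreover have "sets (lborel \<Otimes>\<^sub>M lborel :: (real \<times> real) measure) = sets (borel \<Otimes>\<^sub>M borel)"
      by (intro sets_pair_measure_cong sets_lborel)
    ultimately show ?thesis by (simp add: pred_def space_pair_measure)
  qed
  have "emeasure M {\<omega> \<in> space M. X \<omega> \<in> A \<and> Z \<omega> \<in> B}
      = emeasure M ((\<lambda>\<omega>. (X \<omega>, Y \<omega>)) -` ?S \<inter> space M)"
  proof (rule emeasure_eq_AE)
    show "AE \<omega> in M. \<omega> \<in> {\<omega> \<in> space M. X \<omega> \<in> A \<and> Z \<omega> \<in> B}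
        \<longleftrightarrow> \<omega> \<in> (\<lambda>\<omega>. (X \<omega>, Y \<omega>)) -` ?S \<inter> space M"
      using X_pos Z_eq by eventually_elim auto
    show "(\<lambda>\<omega>. (X \<omega>, Y \<omega>)) -` ?S \<inter> space M \<in> events"
      using distributed_measurable[OF joint] S by (rule measurable_sets)
  qed measurable
  also have "\<dots> = (\<integral>\<^sup>+z. (case z of (x, y) \<Rightarrow> ennreal (f x) * ennreal (g y)) * indicator ?S z
      \<partial>(lborel \<Otimes>\<^sub>M lborel))"
    by (rule distributed_emeasure[OF joint S])
  also have "\<dots> = (\<integral>\<^sup>+x. \<integral>\<^sup>+y. ennreal (f x) * ennreal (g y) * indicator ?S (x, y) \<partial>lborel \<partial>lborel)"
    by (subst lborel.nn_integral_fst[symmetric]) simp_all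
  also have "\<dots> = (\<integral>\<^sup>+x. (\<integral>\<^sup>+u. ennreal (indicator {0<..} x * ((1 + x) * f x * g (u * (1 + x))))
      * indicator B u \<partial>lborel) * indicator A x \<partial>lborel)"
  proof (rule nn_integral_cong)
    fix x :: real
    show "(\<integral>\<^sup>+y. ennreal (f x) * ennreal (g y) * indicator ?S (x, y) \<partial>lborel)
      = (\<integral>\<^sup>+u. ennreal (indicator {0<..} x * ((1 + x) * f x * g (u * (1 + x))))
          * indicator B u \<partial>lborel) * indicator A x"
    proof (cases "0 < x \<and> x \<in> A")
      case True
      have "(\<integral>\<^sup>+y. ennreal (f x) * ennreal (g y) * indicator ?S (x, y) \<partial>lborel)
          = (\<integral>\<^sup>+y. ennreal (f x) * ennreal (g y) * indicator B (y / (1 + x)) \<partial>lborel)"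
        using True by (intro nn_integral_cong) (auto simp: indicator_def)
      \<comment> \<open>The substitution \<open>y = (1 + x) * u\<close> at fixed \<open>x\<close>
        contributes the Jacobian \<open>1 + x\<close>.\<close>
      also have "\<dots> = ennreal \<bar>1 + x\<bar> * (\<integral>\<^sup>+u. ennreal (f x) * ennreal (g (0 + (1 + x) * u))
          * indicator B ((0 + (1 + x) * u) / (1 + x)) \<partial>lborel)"
        using True by (intro nn_integral_real_affine) auto
      also have "\<dots> = (\<integral>\<^sup>+u. ennreal \<bar>1 + x\<bar> * (ennreal (f x) * ennreal (g (0 + (1 + x) * u))
          * indicator B ((0 + (1 + x) * u) / (1 + x))) \<partial>lborel)"
        by (intro nn_integral_cmult[symmetric]) measurable
      also have "\<dots> = (\<integral>\<^sup>+u. ennreal ((1 + x) * f x * g (u * (1 + x))) * indicator B u \<partial>lborel)"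
        using True f g by (intro nn_integral_cong) (simp add: ennreal_mult mult.assoc mult.commute[of _ "1 + x"])
      finally show ?thesis using True by simp
    qed (auto simp: indicator_def)
  qed
  finally show "emeasure M {\<omega> \<in> space M. X \<omega> \<in> A \<and> Z \<omega> \<in> B}
    = (\<integral>\<^sup>+x. (\<integral>\<^sup>+u. (case (x, u) of (x, u) \<Rightarrow>
        ennreal (indicator {0<..} x * ((1 + x) * f x * g (u * (1 + x))))) * indicator B u \<partial>lborel)
        * indicator A x \<partial>lborel)"
    by simp
qed (auto intro: lborel.sigma_finite_measure_axioms)

text \<open>The joint law of \<open>X\<close> and \<open>U\<close> is computed twice, from
  \<open>(X, Y)\<close> with quotient \<open>U\<close> and from \<open>(U, V)\<close> with quotient
  \<open>X\<close>; joint densities are unique almost everywhere.\<close>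

lemma (in prob_space) prod_eqn_densities:
  fixes X Y U V :: "'a \<Rightarrow> real"
  assumes indep: "indep_var borel X borel Y" "indep_var borel U borel V"
    and X: "distributed M lborel X (\<lambda>x. ennreal (f x))" and f: "\<And>x. 0 \<le> f x"
    and Y: "distributed M lborel Y (\<lambda>x. ennreal (g x))" and g: "\<And>x. 0 \<le> g x"
    and U: "distributed M lborel U (\<lambda>x. ennreal (h x))" and h: "\<And>x. 0 \<le> h x"
    and V: "distributed M lborel V (\<lambda>x. ennreal (k x))" and k: "\<And>x. 0 \<le> k x"
    and pos: "AE \<omega> in M. 0 < X \<omega>" "AE \<omega> in M. 0 < U \<omega>"
    and U_eq: "AE \<omega> in M. U \<omega> = Y \<omega> / (1 + X \<omega>)"
    and X_eq: "AE \<omega> in M. X \<omega> = V \<omega> / (1 + U \<omega>)"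
  shows "prod_eqn f g h k"
proof -
  have XU: "distributed M (lborel \<Otimes>\<^sub>M lborel) (\<lambda>\<omega>. (X \<omega>, U \<omega>))
     (\<lambda>(x, u). ennreal (indicator {0<..} x * ((1 + x) * f x * g (u * (1 + x)))))"
    using distributed_measurable[OF U] by (intro distributed_quotient[OF indep(1) X f Y g pos(1) _ U_eq]) simp
  have UX: "distributed M (lborel \<Otimes>\<^sub>M lborel) (\<lambda>\<omega>. (U \<omega>, X \<omega>))
     (\<lambda>(u, x). ennreal (indicator {0<..} u * ((1 + u) * h u * k (x * (1 + u)))))"
    using distributed_measurable[OF X] by (intro distributed_quotient[OF indep(2) U h V k pos(2) _ X_eq]) simp
  have "AE z in lborel \<Otimes>\<^sub>M lborel.
      (\<lambda>(x, u). ennreal (indicator {0<..} x * ((1 + x) * f x * g (u * (1 + x))))) z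
    = (\<lambda>(x, u). (\<lambda>(u, x). ennreal (indicator {0<..} u * ((1 + u) * h u * k (x * (1 + u))))) (u, x)) z"
    by (intro distributed_unique[OF XU] distributed_swap[OF _ _ UX] lborel.sigma_finite_measure_axioms)
  from lborel_pair.AE_pair[OF this] show ?thesis
    unfolding prod_eqn_def
  proof eventually_elim
    case (elim x)
    thus ?case
    proof eventually_elim
      case (elim u)
      show ?case
      proof (intro impI)
        assume "0 < x" "0 < u"
        with elim f[of x] g[of "u * (1 + x)"] h[of u] k[of "x * (1 + u)"]
        show "(1 + x) * f x * g (u * (1 + x)) = (1 + u) * h u * k (x * (1 + u))"
          by (simp add: ennreal_inj)
      qed
    qed
  qed
qed

lemma (in prob_space) density_zero_nonpos:
  fixes X :: "'a \<Rightarrow> real"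
  assumes X: "distributed M lborel X (\<lambda>x. ennreal (f x))" and f: "\<And>x. 0 \<le> f x"
    and pos: "AE \<omega> in M. 0 < X \<omega>"
  shows "AE x in lborel. x \<le> 0 \<longrightarrow> f x = 0"
proof -
  have [measurable]: "f \<in> borel_measurable borel"
    using distributed_real_measurable[OF _ X] f by auto
  have "emeasure M (X -` {..0} \<inter> space M) = 0"
    using pos distributed_measurable[OF X]
    by (intro AE_iff_measurable[THEN iffD1, of _ M "\<lambda>\<omega>. 0 < X \<omega>"]) (auto simp: not_less intro: measurable_sets)
  hence "(\<integral>\<^sup>+x. ennreal (f x) * indicator {..0} x \<partial>lborel) = 0"
    using distributed_emeasure[OF X, of "{..0}"] by simp
  hence "AE x in lborel. ennreal (f x) * indicator {..0} x = 0"
    by (subst (asm) nn_integral_0_iff_AE) auto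
  thus ?thesis
  proof eventually_elim
    case (elim x)
    thus ?case using f[of x] by (auto simp: indicator_def ennreal_eq_0_iff split: if_splits)
  qed
qed

text \<open>Since \<open>f\<close> has total mass one, proportionality determines the constant as
  the inverse of the integral of \<open>q\<close>.\<close>

lemma (in prob_space) normalized_density_iff:
  fixes X :: "'a \<Rightarrow> real"
  assumes X: "distributed M lborel X (\<lambda>x. ennreal (f x))" and f: "\<And>x. 0 \<le> f x"
    and pos: "AE \<omega> in M. 0 < X \<omega>"
    and q [measurable]: "q \<in> borel_measurable borel" and q_nonneg: "\<And>x. 0 \<le> q x"
    and q_zero: "\<And>x. x \<le> 0 \<Longrightarrow> q x = 0"
  shows "distributed M lborel X (\<lambda>x. ennreal (q x / (\<integral>t. q t \<partial>lborel))) \<longleftrightarrow> proportional f q" (is "?D \<longleftrightarrow> _")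
    and "proportional f q \<Longrightarrow> integrable lborel q"
proof -
  have [measurable]: "f \<in> borel_measurable borel"
    using distributed_real_measurable[OF _ X] f by auto
  let ?I = "\<integral>t. q t \<partial>lborel"
  have "(\<integral>\<^sup>+x. ennreal (f x) * 1 \<partial>lborel) = (\<integral>\<^sup>+\<omega>. 1 \<partial>M)"
    by (rule distributed_nn_integral[OF X]) simp
  hence nn: "(\<integral>\<^sup>+x. ennreal (f x) \<partial>lborel) = 1" by (simp add: emeasure_space_1)
  hence int_f: "integrable lborel f" and int_f1: "(\<integral>x. f x \<partial>lborel) = 1"
    using f by (auto intro!: integrableI_nonneg simp: integral_eq_nn_integral)
  have *: "integrable lborel q \<and> ?D" if pq: "proportional f q"
  proof -
    obtain \<kappa> where \<kappa>: "AE x in lborel. 0 < x \<longrightarrow> f x = \<kappa> * q x"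
      using pq unfolding proportional_def by blast
    have eq: "AE x in lborel. f x = \<kappa> * q x"
      using \<kappa> density_zero_nonpos[OF X f pos] by eventually_elim (auto simp: q_zero not_less)
    have "(\<integral>x. f x \<partial>lborel) = (\<integral>x. \<kappa> * q x \<partial>lborel)"
      using eq by (intro integral_cong_AE) auto
    \<comment> \<open>Valid before \<open>q\<close> is known to be integrable, as the integral
      defaults to 0 otherwise; it makes \<kappa> nonzero, and integrability of \<open>q\<close>
      follows from that of \<open>f\<close>.\<close>
    hence norm: "\<kappa> * ?I = 1" using int_f1 by simp
    have "integrable lborel (\<lambda>x. \<kappa> * q x)"
      using int_f by (rule integrable_cong_AE_imp) (use eq in \<open>auto simp: eq_commute\<close>)
    hence int_q: "integrable lborel q" using norm by (auto simp: integrable_mult_left_iff)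
    have \<kappa>_eq: "\<kappa> = 1 / ?I" using norm by (metis nonzero_eq_divide_eq mult_zero_right zero_neq_one)
    have "AE x in lborel. ennreal (f x) = ennreal (q x / ?I)"
      using eq by eventually_elim (simp add: \<kappa>_eq)
    hence ?D using X by (subst (asm) distributed_cong_density) auto
    with int_q show ?thesis by blast
  qed
  show "proportional f q \<Longrightarrow> integrable lborel q" using * by blast
  show "?D \<longleftrightarrow> proportional f q"
  proof
    \<comment> \<open>Division by zero yields 0, so the constant \<open>1 / ?I\<close> serves
      without a case distinction.\<close>
    assume ?D
    from distributed_unique[OF X this] have "AE x in lborel. 0 < x \<longrightarrow> f x = (1 / ?I) * q x"
    proof eventually_elim
      case (elim x)
      have "0 \<le> ?I" using q_nonneg by simp
      thus ?case using elim f[of x] q_nonneg[of x] by (simp add: ennreal_inj)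
    qed
    thus "proportional f q" unfolding proportional_def by blast
  qed (use * in blast)
qed

section \<open>Passage to the logarithms of the densities\<close>

lemma loc_int_of_locally_integrable_pos:
  assumes "locally_integrable_pos f" shows "loc_int f"
  unfolding loc_int_def
proof (intro allI impI)
  fix s t :: real assume "0 < s"
  hence "set_integrable lebesgue {s..t} f"
    using assms unfolding locally_integrable_pos_def by (auto dest: spec[of _ "{s..t}"])
  thus "f integrable_on {s..t}" by (rule set_lebesgue_integral_eq_integral(1))
qed

text \<open>The weight is the logarithm of the Jacobian factor in the product equation.\<close>

lemma loc_int_ln_weight:
  assumes "loc_int f" shows "loc_int (\<lambda>x. ln (1 + x) + f x)"
proof -
  have "loc_int (\<lambda>x. ln (1 + x))"
    by (rule loc_int_continuous) (auto intro!: continuous_intros)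
  with assms show ?thesis unfolding loc_int_def by (auto intro: integrable_add)
qed

lemma ae_eqn_of_prod_eqn:
  assumes ae: "prod_eqn f g h k" and pos: "ae_pos f" "ae_pos g" "ae_pos h" "ae_pos k"
  shows "ae_eqn (\<lambda>x. ln (1 + x) + ln (f x)) (\<lambda>y. ln (g y)) (\<lambda>u. ln (1 + u) + ln (h u)) (\<lambda>v. ln (k v))"
  unfolding ae_eqn_def
  using ae[unfolded prod_eqn_def] pos(1)[unfolded ae_pos_def]
proof eventually_elim
  case (elim x)
  show ?case
  proof (cases "0 < x")
    case x: True
    have "AE u in lborel. 0 < u \<longrightarrow> 0 < g ((1 + x) * u)"
      using AE_pos_scale[OF pos(2)[unfolded ae_pos_def], of "1 + x"] x by simp
    with elim(1) AE_pos_shift_scale[OF pos(4)[unfolded ae_pos_def] x] pos(3)[unfolded ae_pos_def]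
    show ?thesis
    proof eventually_elim
      case (elim u)
      show ?case
      proof (intro impI)
        assume "0 < u"
        hence p: "0 < f x" "0 < h u" "0 < g (u * (1 + x))" "0 < k (x * (1 + u))"
          and eq: "(1 + x) * f x * g (u * (1 + x)) = (1 + u) * h u * k (x * (1 + u))"
          using elim \<open>0 < x \<longrightarrow> 0 < f x\<close> x by (simp_all add: mult.commute)
        from arg_cong[OF eq, of ln] show "ln (1 + x) + ln (f x) + ln (g (u * (1 + x)))
            = ln (1 + u) + ln (h u) + ln (k (x * (1 + u)))"
          using p x \<open>0 < u\<close> by (simp add: ln_mult)
      qed
    qed
  qed simp
qed

lemma proportional_gamma_of_ln:
  assumes ln: "AE y in lborel. 0 < y \<longrightarrow> ln (g y) = \<beta> * ln y - \<gamma> * y + k" and g: "ae_pos g"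
  shows "proportional g (gamma_kernel (\<beta> + 1) \<gamma>)"
proof -
  have "AE y in lborel. 0 < y \<longrightarrow> g y = exp k * gamma_kernel (\<beta> + 1) \<gamma> y"
    using ln g[unfolded ae_pos_def]
  proof eventually_elim
    case (elim y)
    show ?case
    proof
      assume y: "0 < y"
      with elim have "g y = exp (\<beta> * ln y - \<gamma> * y + k)" by (metis exp_ln)
      also have "\<dots> = exp k * (y powr \<beta> * exp (- \<gamma> * y))"
        using y by (simp add: powr_def exp_add[symmetric] algebra_simps)
      finally show "g y = exp k * gamma_kernel (\<beta> + 1) \<gamma> y" using y by (simp add: gamma_kernel_def)
    qed
  qed
  thus ?thesis unfolding proportional_def by blast
qed

theorem lemma1:
  fixes M :: "'a measure"
    and X Y U V :: "'a \<Rightarrow> real"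
    and fX fY fU fV :: "real \<Rightarrow> real"
  assumes M: "prob_space M"
    and X_pos: "AE \<omega> in M. 0 < X \<omega>"
    and Y_pos: "AE \<omega> in M. 0 < Y \<omega>"
    and indep_XY: "prob_space.indep_var M borel X borel Y"
    and fX: "has_real_density M X fX" and fX_pos: "\<forall>x>0. 0 < fX x"
    and fY: "has_real_density M Y fY" and fY_pos: "\<forall>x>0. 0 < fY x"
    and U: "U = (\<lambda>\<omega>. Y \<omega> / (1 + X \<omega>))"
    and V: "V = (\<lambda>\<omega>. X \<omega> * (1 + Y \<omega> / (1 + X \<omega>)))"
    and indep_UV: "prob_space.indep_var M borel U borel V"
    and fU: "has_real_density M U fU"
    and fV: "has_real_density M V fV"
    and ln_fX: "locally_integrable_pos (\<lambda>x. ln (fX x))"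
    and ln_fY: "locally_integrable_pos (\<lambda>x. ln (fY x))"
    and ln_fU: "locally_integrable_pos (\<lambda>x. ln (fU x))"
    and ln_fV: "locally_integrable_pos (\<lambda>x. ln (fV x))"
  shows "(\<exists>a b c. 0 < a \<and> 0 < b \<and> 0 < c \<and>
            kummer_distributed M X a (b - a) c \<and> gamma_distributed M Y b c) \<and>
         (\<forall>a b c. 0 < a \<longrightarrow> 0 < b \<longrightarrow> 0 < c \<longrightarrow>
            (kummer_distributed M X a (b - a) c \<and> gamma_distributed M Y b c \<longleftrightarrow>
             kummer_distributed M U b (a - b) c \<and> gamma_distributed M V a c))"
proof -
  interpret prob_space M by fact
  note densities = fX fY fU fV
  have nonneg: "0 \<le> fX x" "0 \<le> fY x" "0 \<le> fU x" "0 \<le> fV x" for x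
    using densities by (simp_all add: has_real_density_def)
  have distr: "distributed M lborel X (\<lambda>x. ennreal (fX x))" "distributed M lborel Y (\<lambda>x. ennreal (fY x))"
    "distributed M lborel U (\<lambda>x. ennreal (fU x))" "distributed M lborel V (\<lambda>x. ennreal (fV x))"
    using densities by (simp_all add: has_real_density_def)
  have meas [measurable]: "fX \<in> borel_measurable borel" "fY \<in> borel_measurable borel"
    "fU \<in> borel_measurable borel" "fV \<in> borel_measurable borel"
    using distributed_real_measurable[OF _ distr(1)] distributed_real_measurable[OF _ distr(2)]
      distributed_real_measurable[OF _ distr(3)] distributed_real_measurable[OF _ distr(4)] nonneg by auto
  have U_pos: "AE \<omega> in M. 0 < U \<omega>"
    using X_pos Y_pos by eventually_elim (simp add: U)
  have V_pos: "AE \<omega> in M. 0 < V \<omega>"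
    using X_pos Y_pos by eventually_elim (simp add: V add_pos_pos)
  have X_eq: "AE \<omega> in M. X \<omega> = V \<omega> / (1 + U \<omega>)"
    using U_pos by eventually_elim (simp add: V U)
  have eq: "prod_eqn fX fY fU fV"
    by (rule prod_eqn_densities[OF indep_XY indep_UV distr(1) nonneg(1) distr(2) nonneg(2)
        distr(3) nonneg(3) distr(4) nonneg(4) X_pos U_pos _ X_eq]) (simp add: U)
  have eq': "prod_eqn fU fV fX fY" by (rule prod_eqn_swap[OF meas eq])
  \<comment> \<open>Positivity is given for \<open>fX\<close> and \<open>fY\<close>; the product
    equation passes it on to \<open>fU\<close> and \<open>fV\<close>.\<close>
  have pos: "ae_pos fX" "ae_pos fY" using fX_pos fY_pos by (auto simp: ae_pos_def)
  have pos': "ae_pos fU" "ae_pos fV"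
    using prod_eqn_ae_pos[OF eq nonneg(3,4) pos] ae_pos_last[OF eq' nonneg(3,4) pos] by auto

  \<comment> \<open>From here on laws are treated as proportionality to kernels, which removes the
    normalizing constants.\<close>
  have kummer: "kummer_distributed M X a b c \<longleftrightarrow> proportional fX (kummer_kernel a b c)"
    "kummer_distributed M U a b c \<longleftrightarrow> proportional fU (kummer_kernel a b c)" for a b c
    using normalized_density_iff(1)[OF distr(1) nonneg(1) X_pos, of "kummer_kernel a b c"]
      normalized_density_iff(1)[OF distr(3) nonneg(3) U_pos, of "kummer_kernel a b c"]
    by (simp_all add: kummer_distributed_def kummer_density_def kummer_kernel_nonneg kummer_kernel_nonpos)
  have gamma: "gamma_distributed M Y b c \<longleftrightarrow> proportional fY (gamma_kernel b c)"
    "gamma_distributed M V b c \<longleftrightarrow> proportional fV (gamma_kernel b c)" for b c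
    using normalized_density_iff(1)[OF distr(2) nonneg(2) Y_pos, of "gamma_kernel b c"]
      normalized_density_iff(1)[OF distr(4) nonneg(4) V_pos, of "gamma_kernel b c"]
    by (simp_all add: gamma_distributed_def gamma_density_def gamma_kernel_nonneg gamma_kernel_nonpos)
  have gamma_pos: "0 < b \<and> 0 < c" if "proportional fY (gamma_kernel b c)" for b c
    using that
    by (intro gamma_kernel_integrable_imp normalized_density_iff(2)[OF distr(2) nonneg(2) Y_pos])
       (auto simp: gamma_kernel_nonneg gamma_kernel_nonpos)
  have gamma_pos': "0 < a \<and> 0 < c" if "proportional fV (gamma_kernel a c)" for a c
    using that
    by (intro gamma_kernel_integrable_imp normalized_density_iff(2)[OF distr(4) nonneg(4) V_pos])
       (auto simp: gamma_kernel_nonneg gamma_kernel_nonpos)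

  \<comment> \<open>By \<open>kernel_identity\<close> the kernels solve the product equation
    pointwise and serve as the reference solution.\<close>
  have first: "proportional fX (kummer_kernel a (b - a) c)"
    if "proportional fY (gamma_kernel b c)" "proportional fV (gamma_kernel a c)" for a b c
    using proportional_first[OF eq' kernel_identity gamma_kernel_pos kummer_kernel_pos pos(2) that] .
  have first': "proportional fU (kummer_kernel b (a - b) c)"
    if "proportional fY (gamma_kernel b c)" "proportional fV (gamma_kernel a c)" for a b c
    using proportional_first[OF eq kernel_identity gamma_kernel_pos kummer_kernel_pos pos'(2) that(2,1)] .
  have last: "proportional fV (gamma_kernel a c)"
    if "proportional fX (kummer_kernel a (b - a) c)" "proportional fY (gamma_kernel b c)" for a b c
    using proportional_last[OF eq' kernel_identity pos'(1) that] .
  have last': "proportional fY (gamma_kernel b c)"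
    if "proportional fU (kummer_kernel b (a - b) c)" "proportional fV (gamma_kernel a c)" for a b c
    using proportional_last[OF eq kernel_identity pos(1) that] .

  have ae: "ae_eqn (\<lambda>x. ln (1 + x) + ln (fX x)) (\<lambda>y. ln (fY y)) (\<lambda>u. ln (1 + u) + ln (fU u)) (\<lambda>v. ln (fV v))"
    by (rule ae_eqn_of_prod_eqn[OF eq pos pos'])
  obtain \<beta> \<gamma> k \<alpha> l where
    "AE y in lborel. 0 < y \<longrightarrow> ln (fY y) = \<beta> * ln y - \<gamma> * y + k"
    "AE v in lborel. 0 < v \<longrightarrow> ln (fV v) = \<alpha> * ln v - \<gamma> * v + l"
  proof (rule ae_eqn_solution[OF _ _ _ _ ae])
    show "loc_int (\<lambda>x. ln (1 + x) + ln (fX x))" "loc_int (\<lambda>u. ln (1 + u) + ln (fU u))"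
      "loc_int (\<lambda>y. ln (fY y))" "loc_int (\<lambda>v. ln (fV v))"
      by (intro loc_int_ln_weight loc_int_of_locally_integrable_pos ln_fX ln_fY ln_fU ln_fV)+
  qed measurable
  hence Y: "proportional fY (gamma_kernel (\<beta> + 1) \<gamma>)" and V: "proportional fV (gamma_kernel (\<alpha> + 1) \<gamma>)"
    using proportional_gamma_of_ln pos(2) pos'(2) by metis+
  \<comment> \<open>The witnesses are \<open>a = \<alpha> + 1\<close>,
    \<open>b = \<beta> + 1\<close> and \<open>c = \<gamma>\<close>, the shift coming from the
    exponent in the kernel; integrability of the kernels makes them positive.\<close>
  have "\<exists>a b c. 0 < a \<and> 0 < b \<and> 0 < c \<and>
            kummer_distributed M X a (b - a) c \<and> gamma_distributed M Y b c"
    using gamma_pos[OF Y] gamma_pos'[OF V] first[OF Y V] Y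
    unfolding kummer gamma by blast
  \<comment> \<open>The laws of \<open>X\<close> and \<open>Y\<close> give that of \<open>V\<close>
    by \<open>last\<close>, then that of \<open>U\<close> by \<open>first'\<close>; conversely
    \<open>last'\<close> gives \<open>Y\<close> and then \<open>first\<close> gives
    \<open>X\<close>.\<close>
  moreover have "kummer_distributed M X a (b - a) c \<and> gamma_distributed M Y b c \<longleftrightarrow>
             kummer_distributed M U b (a - b) c \<and> gamma_distributed M V a c" for a b c
    unfolding kummer gamma using first[of b c a] first'[of b c a] last[of a b c] last'[of b a c] by blast
  ultimately show ?thesis by blast
qed

end
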